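(* Let $n\ge 3$. For the $n$-dimensional rigid body with a flat face rubber-rolling on a sphere (as in the context), the reduced equations of motion on $T^*\mathbb R^{n-1}$ possess an invariant measure of the form $\exp(\sigma(s))\,\nu$ with $\sigma\in C^\infty(\mathbb R^{n-1})$, and the system admits a Chaplygin Hamiltonisation, provided one of the following holds: (C1) $\mathbb J=\mathrm{diag}(J_1,J_2,\dots,J_n)$ and $a=0$; (C2) $\mathbb J=\mathrm{diag}(J_1,\dots,J_1,J_n)$.
   Context: Fix $n\ge3$, $R>0$, $a\in\mathbb R$, $m>0$, symmetric positive definite $n\times n$ matrix $\mathbb J$. Configuration space $Q=\mathbb R^{n-1}\times SO(n)\ni((X_1,\dots,X_{n-1}),g)$, $X=(X_1,\dots,X_{n-1},R+a)^T$, $\Omega=g^{-1}\dot g\in\mathfrak{so}(n)$, $E_1,\dots,E_n$ the standard basis of $\mathbb R^n$. Lagrangian $L=\frac12(\mathbb J\Omega+\Omega\mathbb J,\Omega)_\kappa+\frac m2\|\dot X+\Omega X\|^2$ with $(\xi,\eta)_\kappa=-\frac12\mathrm{tr}(\xi\eta)$, $\dot X_n=0$. Constraints: $\dot X=-R\Omega E_n$ and $\Omega_{\mu\nu}=0$ for $1\le\mu,\nu\le n-1$, defining a distribution $\mathcal D$. The action $h\cdot(X,g)=(X,hg)$ of $SO(n)$ makes this an $SO(n)$-Chaplygin system with shape space $S=\mathbb R^{n-1}$, coordinates $s_i=X_i$, $r=n-1$. Its reduced equations on $T^*S$ are $\dot s_i=\partial H/\partial p_i$, $\dot p_i=-\partial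 H/\partial s_i-\sum_{j,k}C_{ij}^kp_k\partial H/\partial p_j$, where $H=\frac12\sum K^{ij}p_ip_j$, $K_{ij}=\langle\mathrm{hor}_q\partial_{s_i},\mathrm{hor}_q\partial_{s_j}\rangle$ (horizontal lift into $\mathcal D_q$, metric given by $L$), $K^{ij}$ its inverse, and $C_{ij}^k=\sum_lK^{kl}\langle[\mathrm{hor}_q\partial_{s_i},\mathrm{hor}_q\partial_{s_j}],\mathrm{hor}_q\partial_{s_l}\rangle$. $\nu=ds_1\cdots ds_{n-1}dp_1\cdots dp_{n-1}$ is the Liouville volume. A Chaplygin Hamiltonisation is a smooth $\phi:S\to\mathbb R$ such that under $dt=e^{-\phi(s)}d\tau$, $p_i=e^{-\phi(s)}\tilde p_i$ the reduced equations become $ds_i/d\tau=\partial\tilde H/\partial\tilde p_i$, $d\tilde p_i/d\tau=-\partial\tilde H/\partial s_i$ with $\tilde H(s,\tilde p)=H(s,e^{-\phi(s)}\tilde p)$. *)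

theory Defs
  imports "HOL-Analysis.Analysis"
begin

text \<open>Conventions. The shape space S = R^(n-1) is modelled as real^'m, where the
finite type 'm indexes the first n-1 coordinates. Vectors of R^n and n x n
matrices are indexed by 'm option: index Some i is the i-th of the first n-1
coordinates and index None is the n-th coordinate (so E_n = axis None 1).
Thus n = CARD('m) + 1.  The configuration space Q = R^(n-1) x SO(n) sits in the
ambient space real^'m x real^('m option)^('m option); a tangent vector at (X,g)
is a pair (Xdot, gdot) with Omega = g^(-1) gdot.\<close>

type_synonym ('m) amb = "(real^('m::finite)) \<times> (real^('m option)^('m option))"

definition kappa :: "real^'n^'n \<Rightarrow> real^'n^'n \<Rightarrow> real" where
  "kappa \<xi> \<eta> = - (1/2) * trace (\<xi> ** \<eta>)"

definition fullX :: "real \<Rightarrow> real \<Rightarrow> real^('m::finite) \<Rightarrow> real^('m option)" where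
  "fullX R a x = (\<chi> k. case k of None \<Rightarrow> R + a | Some i \<Rightarrow> x $ i)"

definition fullXd :: "real^('m::finite) \<Rightarrow> real^('m option)" where
  "fullXd xd = (\<chi> k. case k of None \<Rightarrow> 0 | Some i \<Rightarrow> xd $ i)"

definition Omega_of :: "('m::finite) amb \<Rightarrow> ('m::finite) amb \<Rightarrow> real^('m option)^('m option)" where
  "Omega_of q v = matrix_inv (snd q) ** snd v"

definition Lag :: "real \<Rightarrow> real \<Rightarrow> real \<Rightarrow> real^('m option)^('m option)
    \<Rightarrow> ('m::finite) amb \<Rightarrow> ('m::finite) amb \<Rightarrow> real" where
  "Lag R a mass J q v =
     (let \<Omega> = Omega_of q v in
       (1/2) * kappa (J ** \<Omega> + \<Omega> ** J) \<Omega>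
       + (mass/2) * (norm (fullXd (fst v) + \<Omega> *v fullX R a (fst q)))\<^sup>2)"

text \<open>The kinetic-energy metric defined by L (polarisation of the quadratic form L = 1/2 <v,v>).\<close>
definition metric :: "real \<Rightarrow> real \<Rightarrow> real \<Rightarrow> real^('m option)^('m option)
    \<Rightarrow> ('m::finite) amb \<Rightarrow> ('m::finite) amb \<Rightarrow> ('m::finite) amb \<Rightarrow> real" where
  "metric R a mass J q v w =
     Lag R a mass J q (v + w) - Lag R a mass J q v - Lag R a mass J q w"

definition Dist :: "real \<Rightarrow> ('m::finite) amb \<Rightarrow> ('m::finite) amb set" where
  "Dist R q = {v. let \<Omega> = Omega_of q v in
       transpose \<Omega> = - \<Omega>
     \<and> fullXd (fst v) = - R *\<^sub>R (\<Omega> *v axis None 1)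
     \<and> (\<forall>\<mu> \<nu>. \<Omega> $ Some \<mu> $ Some \<nu> = 0)}"

definition hor :: "real \<Rightarrow> ('m::finite) amb \<Rightarrow> 'm \<Rightarrow> ('m::finite) amb" where
  "hor R q i = (THE v. v \<in> Dist R q \<and> fst v = axis i 1)"

text \<open>Lie bracket of vector fields on (an open subset of) the ambient Euclidean
space; Q is a submanifold to which the fields considered are tangent.\<close>
definition lie_bracket :: "('a::real_normed_vector \<Rightarrow> 'a) \<Rightarrow> ('a \<Rightarrow> 'a) \<Rightarrow> 'a \<Rightarrow> 'a" where
  "lie_bracket Y Z q = frechet_derivative Z (at q) (Y q) - frechet_derivative Y (at q) (Z q)"

text \<open>Base point over s (K and C are independent of g by SO(n)-invariance; we evaluate at g = identity).\<close>
definition basept :: "real^'m \<Rightarrow> ('m::finite) amb" where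
  "basept s = (s, mat 1)"

definition Kmat :: "real \<Rightarrow> real \<Rightarrow> real \<Rightarrow> real^('m option)^('m option) \<Rightarrow> real^('m::finite) \<Rightarrow> real^'m^'m" where
  "Kmat R a mass J s = (\<chi> i j. metric R a mass J (basept s) (hor R (basept s) i) (hor R (basept s) j))"

definition Kinv :: "real \<Rightarrow> real \<Rightarrow> real \<Rightarrow> real^('m option)^('m option) \<Rightarrow> real^('m::finite) \<Rightarrow> real^'m^'m" where
  "Kinv R a mass J s = matrix_inv (Kmat R a mass J s)"

definition Ccoef :: "real \<Rightarrow> real \<Rightarrow> real \<Rightarrow> real^('m option)^('m option) \<Rightarrow> real^('m::finite)
    \<Rightarrow> 'm \<Rightarrow> 'm \<Rightarrow> 'm \<Rightarrow> real" where
  "Ccoef R a mass J s i j k =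
     (\<Sum>l\<in>UNIV. Kinv R a mass J s $ k $ l *
        metric R a mass J (basept s)
          (lie_bracket (\<lambda>q. hor R q i) (\<lambda>q. hor R q j) (basept s))
          (hor R (basept s) l))"

definition Ham :: "real \<Rightarrow> real \<Rightarrow> real \<Rightarrow> real^('m option)^('m option) \<Rightarrow> real^('m::finite) \<Rightarrow> real^'m \<Rightarrow> real" where
  "Ham R a mass J s p = (1/2) * (\<Sum>i\<in>UNIV. \<Sum>j\<in>UNIV. Kinv R a mass J s $ i $ j * p $ i * p $ j)"

definition dP :: "(real^('m::finite) \<Rightarrow> real^'m \<Rightarrow> real) \<Rightarrow> real^'m \<Rightarrow> real^'m \<Rightarrow> 'm \<Rightarrow> real" where
  "dP F s p i = deriv (\<lambda>t. F s (p + t *\<^sub>R axis i 1)) 0"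

definition dS :: "(real^('m::finite) \<Rightarrow> real^'m \<Rightarrow> real) \<Rightarrow> real^'m \<Rightarrow> real^'m \<Rightarrow> 'm \<Rightarrow> real" where
  "dS F s p i = deriv (\<lambda>t. F (s + t *\<^sub>R axis i 1) p) 0"

definition reducedVF :: "real \<Rightarrow> real \<Rightarrow> real \<Rightarrow> real^('m option)^('m option)
    \<Rightarrow> ((real^('m::finite)) \<times> (real^'m)) \<Rightarrow> ((real^'m) \<times> (real^'m))" where
  "reducedVF R a mass J z =
     (let s = fst z; p = snd z; H = Ham R a mass J in
       ((\<chi> i. dP H s p i),
        (\<chi> i. - dS H s p i
              - (\<Sum>j\<in>UNIV. \<Sum>k\<in>UNIV. Ccoef R a mass J s i j k * p $ k * dP H s p j))))"

definition hamVF :: "(real^('m::finite) \<Rightarrow> real^'m \<Rightarrow> real) \<Rightarrow> ((real^'m) \<times> (real^'m)) \<Rightarrow> ((real^'m) \<times> (real^'m))" where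
  "hamVF F z = ((\<chi> i. dP F (fst z) (snd z) i), (\<chi> i. - dS F (fst z) (snd z) i))"

fun Ck :: "nat \<Rightarrow> (real^('m::finite) \<Rightarrow> real) \<Rightarrow> bool" where
  "Ck 0 f = continuous_on UNIV f"
| "Ck (Suc k) f = ((\<forall>x. f differentiable (at x)) \<and> continuous_on UNIV f \<and>
                    (\<forall>i. Ck k (\<lambda>x. frechet_derivative f (at x) (axis i 1))))"

definition smooth_fun :: "(real^('m::finite) \<Rightarrow> real) \<Rightarrow> bool" where
  "smooth_fun f = (\<forall>k. Ck k f)"

definition flow_reach :: "('a::euclidean_space \<Rightarrow> 'a) \<Rightarrow> real \<Rightarrow> 'a \<Rightarrow> 'a \<Rightarrow> bool" where
  "flow_reach V t z y = (\<exists>x. x 0 = z \<and> x t = y \<and>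
      (\<forall>\<tau>\<in>closed_segment 0 t. (x has_vector_derivative V (x \<tau>)) (at \<tau> within closed_segment 0 t)))"

definition invariant_measure :: "('a::euclidean_space \<Rightarrow> 'a) \<Rightarrow> ('a \<Rightarrow> real) \<Rightarrow> bool" where
  "invariant_measure V \<rho> = (\<forall>t A. A \<in> sets borel \<and> A \<subseteq> {z. \<exists>y. flow_reach V t z y} \<longrightarrow>
      emeasure (density lborel (\<lambda>z. ennreal (\<rho> z))) {y. \<exists>z\<in>A. flow_reach V t z y}
      = emeasure (density lborel (\<lambda>z. ennreal (\<rho> z))) A)"

text \<open>Chaplygin Hamiltonisation: phi smooth, and under dt = e^(-phi(s)) d tau,
p = e^(-phi(s)) ptilde, every solution of the reduced equations becomes a solution
of Hamilton's equations for Htilde(s,ptilde) = H(s, e^(-phi(s)) ptilde).\<close>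
definition chaplygin_hamiltonisation :: "real \<Rightarrow> real \<Rightarrow> real \<Rightarrow> real^('m option)^('m option)
    \<Rightarrow> (real^('m::finite) \<Rightarrow> real) \<Rightarrow> bool" where
  "chaplygin_hamiltonisation R a mass J \<phi> =
    (smooth_fun \<phi> \<and>
     (\<forall>I T z \<theta>. open I \<and> is_interval I \<and> open T \<and> is_interval T
        \<and> (\<forall>t\<in>I. (z has_vector_derivative reducedVF R a mass J (z t)) (at t))
        \<and> (\<forall>\<tau>\<in>T. \<theta> \<tau> \<in> I \<and> (\<theta> has_real_derivative exp (- \<phi> (fst (z (\<theta> \<tau>))))) (at \<tau>))
        \<longrightarrow> (let w = (\<lambda>\<tau>. (fst (z (\<theta> \<tau>)), exp (\<phi> (fst (z (\<theta> \<tau>)))) *\<^sub>R snd (z (\<theta> \<tau>))));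
                 Ht = (\<lambda>s pt. Ham R a mass J s (exp (- \<phi> s) *\<^sub>R pt))
             in \<forall>\<tau>\<in>T. (w has_vector_derivative hamVF Ht (w \<tau>)) (at \<tau>))))"

end

theory Submission
  imports Defs
begin

text \<open>The reduced metric is \<open>K = (diag d + m s s\<^sup>T) / R\<^sup>2\<close> with \<open>d\<^sub>i = J\<^sub>i + J\<^sub>n + m a\<^sup>2\<close>, and the brackets
of horizontal lifts satisfy \<open>\<langle>[hor i, hor j], hor l\<rangle> = (m a / R\<^sup>3) (s\<^sub>j \<delta>\<^sub>i\<^sub>l - s\<^sub>i \<delta>\<^sub>j\<^sub>l)\<close>. In both cases
(\<open>a = 0\<close>, or all \<open>d\<^sub>i\<close> equal to some \<open>d\<^sub>0\<close>) this gives
\<open>C\<^sub>i\<^sub>j\<^sup>k = b (s\<^sub>j \<delta>\<^sub>k\<^sub>i - s\<^sub>i \<delta>\<^sub>k\<^sub>j)\<close> with \<open>b = m a / (R d\<^sub>0)\<close>, so that \<open>\<phi> = b |s|\<^sup>2 / 2\<close> is a Chaplygin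
multiplier and \<open>exp ((n - 2) \<phi>)\<close> makes the reduced field divergence free.

Invariance under the possibly incomplete flow is Liouville's theorem. It is obtained without
differentiating the flow: one explicit Euler step shrinks the measure of a compact set by at most a
factor \<open>1 - o(h)\<close>, and Euler polygons converge uniformly to solutions, so the flow does not decrease
the measure of compact sets. Reversing time gives equality, and inner regularity extends it to Borel
sets.\<close>

section \<open>Solutions of autonomous differential equations\<close>

text \<open>Contracted with \<open>p\<close> and the velocity \<open>v\<close>, the coefficients
  \<open>C\<close> give the force \<open>- b ((s . v) p - (p . v) s)\<close>. The derivative of
  \<open>exp \<phi>\<close> along the motion, with grad \<open>\<phi>\<close> equal to
  \<open>b s\<close>, absorbs the first term. In the second, \<open>p . v = 2 H\<close> by
  homogeneity, and \<open>2 b H s\<close> is what the factor \<open>exp (- 2 \<phi>)\<close> of the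
  rescaled energy adds to minus its gradient. In the momentum divergence \<open>(s . v) p\<close>
  counts \<open>s . v\<close> r + 1 times and \<open>(p . v) s\<close> twice, which leaves r - 1 = n
  - 2. The loss per step is o(h) because the density pulled back by a step of size h has
  h-derivative div(rho V) = 0 at h = 0, uniformly on compact sets; over t/h steps it adds up to
  o(1). Only one inequality survives the limit: uniform convergence puts the Euler images into every
  neighbourhood of the limit set, so their measures are bounded above by its measure, with no bound
  from below. This is why the reversed field has to supply the other half.\<close>

definition solves :: "('a::real_normed_vector \<Rightarrow> 'a) \<Rightarrow> real \<Rightarrow> (real \<Rightarrow> 'a) \<Rightarrow> bool" where
  "solves V t x \<longleftrightarrow> (\<forall>\<tau>\<in>{0..t}. (x has_vector_derivative V (x \<tau>)) (at \<tau> within {0..t}))"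

definition lipschitz_on_balls :: "('a::real_normed_vector \<Rightarrow> 'a) \<Rightarrow> bool" where
  "lipschitz_on_balls V \<longleftrightarrow>
     (\<forall>N. \<exists>L\<ge>0. \<forall>x\<in>cball 0 N. \<forall>y\<in>cball 0 N. norm (V x - V y) \<le> L * norm (x - y))"

text \<open>This set is closed and the flow is bi-Lipschitz on it, so images of Borel sets are Borel without any
appeal to an existence theorem for differential equations.\<close>

definition trapped :: "('a::real_normed_vector \<Rightarrow> 'a) \<Rightarrow> real \<Rightarrow> real \<Rightarrow> 'a set" where
  "trapped V t N = {x 0 |x. solves V t x \<and> x ` {0..t} \<subseteq> cball 0 N}"

text \<open>A total function for a partial flow: without a solution from \<open>z\<close> up to time
  \<open>t\<close> the value is unspecified. It is therefore evaluated only at points of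
  \<open>trapped\<close> sets or at starting points of given solutions.\<close>

definition flowmap :: "('a::real_normed_vector \<Rightarrow> 'a) \<Rightarrow> real \<Rightarrow> 'a \<Rightarrow> 'a" where
  "flowmap V t z = (THE y. \<exists>x. solves V t x \<and> x 0 = z \<and> x t = y)"

lemma solves_continuous: "solves V t x \<Longrightarrow> continuous_on {0..t} x"
  unfolding solves_def by (auto intro!: has_vector_derivative_continuous simp: continuous_on_eq_continuous_within)

lemma solves_bounded:
  fixes x :: "real \<Rightarrow> 'a::real_normed_vector"
  assumes "solves V t x"
  obtains k :: nat where "x ` {0..t} \<subseteq> cball 0 (real k)"
proof -
  have "bounded (x ` {0..t})"
    using solves_continuous[OF assms] by (intro compact_imp_bounded compact_continuous_image) auto
  then obtain B where "x ` {0..t} \<subseteq> cball 0 B"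
    by (auto simp: bounded_iff subset_iff)
  moreover obtain k :: nat where "B \<le> real k" using real_arch_simple by blast
  ultimately show ?thesis using that by (meson order_trans subset_cball)
qed

lemma solves_reverse:
  assumes "solves V t x"
  shows "solves (\<lambda>z. - V z) t (\<lambda>\<tau>. x (t - \<tau>))"
  unfolding solves_def
proof
  fix \<tau> assume \<tau>: "\<tau> \<in> {0..t}"
  have im: "(\<lambda>s. t - s) ` {0..t} = {0..t}"
    by (auto intro!: image_eqI[where x="t - y" for y])
  have 1: "((\<lambda>s. t - s) has_vector_derivative -1) (at \<tau> within {0..t})"
    by (auto intro!: derivative_eq_intros)
  have 2: "(x has_vector_derivative V (x (t - \<tau>))) (at (t - \<tau>) within (\<lambda>s. t - s) ` {0..t})"
    unfolding im using assms \<tau> by (auto simp: solves_def)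
  show "((\<lambda>\<tau>. x (t - \<tau>)) has_vector_derivative - V (x (t - \<tau>))) (at \<tau> within {0..t})"
    using vector_diff_chain_within[OF 1 2] by (simp add: o_def)
qed

text \<open>The weighted square \<open>exp (- 2 L s) |x - y|^2\<close> is nonincreasing. The square
  is taken because the norm itself need not be differentiable where the two solutions meet.\<close>

lemma gronwall_two_solutions:
  fixes V :: "'a::real_inner \<Rightarrow> 'a"
  assumes x: "solves V t x" "x ` {0..t} \<subseteq> S" and y: "solves V t y" "y ` {0..t} \<subseteq> S"
    and L: "\<And>a b. a \<in> S \<Longrightarrow> b \<in> S \<Longrightarrow> norm (V a - V b) \<le> L * norm (a - b)"
    and \<tau>: "\<tau> \<in> {0..t}"
  shows "norm (x \<tau> - y \<tau>) \<le> exp (L * \<tau>) * norm (x 0 - y 0)"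
proof -
  define d where "d s = x s - y s" for s
  define g where "g s = exp (- 2 * L * s) * (d s \<bullet> d s)" for s
  have d': "(d has_vector_derivative V (x s) - V (y s)) (at s within {0..t})" if "s \<in> {0..t}" for s
    unfolding d_def using x(1) y(1) that by (auto simp: solves_def intro!: derivative_intros)
  have g': "(g has_vector_derivative
      exp (- 2 * L * s) * (2 * (d s \<bullet> (V (x s) - V (y s))) - 2 * L * (d s \<bullet> d s)))
      (at s within {0..t})" if "s \<in> {0..t}" for s
  proof -
    have "((\<lambda>s. d s \<bullet> d s) has_vector_derivative 2 * (d s \<bullet> (V (x s) - V (y s)))) (at s within {0..t})"
      using bounded_bilinear.has_vector_derivative[OF bounded_bilinear_inner d'[OF that] d'[OF that]]
      by (simp add: inner_commute)
    moreover have "((\<lambda>s. exp (- 2 * L * s)) has_vector_derivative exp (- 2 * L * s) * (- 2 * L)) (at s within {0..t})"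
      unfolding has_real_derivative_iff_has_vector_derivative[symmetric]
      by (auto intro!: derivative_eq_intros)
    ultimately show ?thesis
      unfolding g_def has_real_derivative_iff_has_vector_derivative[symmetric]
      by (auto intro!: derivative_eq_intros simp: algebra_simps)
  qed
  have "g \<tau> \<le> g 0"
  proof (rule DERIV_nonpos_imp_decreasing_open[where f=g])
    show "0 \<le> \<tau>" using \<tau> by simp
    show "continuous_on {0..\<tau>} g"
      using continuous_on_subset[OF continuous_on_vector_derivative[OF g']] \<tau> by simp
    fix s assume s: "0 < s" "s < \<tau>"
    then have st: "s \<in> {0..t}" using \<tau> by auto
    have "d s \<bullet> (V (x s) - V (y s)) \<le> norm (d s) * norm (V (x s) - V (y s))"
      by (rule norm_cauchy_schwarz)
    also have "\<dots> \<le> norm (d s) * (L * norm (d s))"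
      using L[of "x s" "y s"] x(2) y(2) st by (intro mult_left_mono) (auto simp: d_def image_subset_iff)
    also have "\<dots> = L * (d s \<bullet> d s)" by (simp add: power2_norm_eq_inner[symmetric] power2_eq_square)
    finally have "exp (- 2 * L * s) * (2 * (d s \<bullet> (V (x s) - V (y s))) - 2 * L * (d s \<bullet> d s)) \<le> 0"
      by (intro mult_nonneg_nonpos) auto
    moreover have "at s within {0..t} = at s"
      using s \<tau> by (intro at_within_interior) auto
    ultimately show "\<exists>y. (g has_real_derivative y) (at s) \<and> y \<le> 0"
      using g'[OF st] by (auto simp: has_real_derivative_iff_has_vector_derivative)
  qed
  then have "exp (- (2 * L * \<tau>)) * (norm (d \<tau>))\<^sup>2 \<le> (norm (d 0))\<^sup>2"
    by (simp add: g_def power2_norm_eq_inner)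
  then have "(norm (d \<tau>))\<^sup>2 \<le> exp (2 * L * \<tau>) * (norm (d 0))\<^sup>2"
    by (simp add: exp_minus field_simps)
  also have "\<dots> = (exp (L * \<tau>) * norm (d 0))\<^sup>2"
    by (simp add: power_mult_distrib flip: exp_of_nat_mult)
  finally show ?thesis
    unfolding d_def[symmetric] by (rule power2_le_imp_le) simp
qed

lemma solves_unique:
  fixes V :: "'a::real_inner \<Rightarrow> 'a"
  assumes V: "lipschitz_on_balls V" and "solves V t x" "solves V t y" "x 0 = y 0" "\<tau> \<in> {0..t}"
  shows "x \<tau> = y \<tau>"
proof -
  obtain k l :: nat where kl: "x ` {0..t} \<subseteq> cball 0 (real k)" "y ` {0..t} \<subseteq> cball 0 (real l)"
    using solves_bounded assms by metis
  let ?B = "cball 0 (max (real k) (real l)) :: 'a set"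
  have "x ` {0..t} \<subseteq> ?B" "y ` {0..t} \<subseteq> ?B"
    using kl by (auto intro: order_trans simp: subset_iff image_iff)
  moreover obtain L where "\<And>a b. a \<in> ?B \<Longrightarrow> b \<in> ?B \<Longrightarrow> norm (V a - V b) \<le> L * norm (a - b)"
    using V unfolding lipschitz_on_balls_def by meson
  ultimately have "norm (x \<tau> - y \<tau>) \<le> exp (L * \<tau>) * norm (x 0 - y 0)"
    using gronwall_two_solutions assms by metis
  then show ?thesis using assms by simp
qed

lemma flowmap_eq:
  fixes V :: "'a::real_inner \<Rightarrow> 'a"
  assumes "lipschitz_on_balls V" "solves V t x" "0 \<le> t"
  shows "flowmap V t (x 0) = x t"
  unfolding flowmap_def
  using assms by (intro the_equality) (auto dest: solves_unique[of V t _ x t])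

lemma trapped_mono: "N \<le> M \<Longrightarrow> trapped V t N \<subseteq> trapped V t M"
  unfolding trapped_def using subset_cball by blast

lemma trapped_subset: "0 \<le> t \<Longrightarrow> trapped V t N \<subseteq> cball 0 N"
  unfolding trapped_def by force

text \<open>The curve run backwards solves the reversed field and has the same range, so the radius
  \<open>N\<close> is kept. This makes the flow map injective with an inverse of the same
  kind.\<close>

lemma flowmap_reverse:
  fixes V :: "'a::real_inner \<Rightarrow> 'a"
  assumes V: "lipschitz_on_balls V" and t: "0 \<le> t" and z: "z \<in> trapped V t N"
  shows "flowmap V t z \<in> trapped (\<lambda>z. - V z) t N"
    and "flowmap (\<lambda>z. - V z) t (flowmap V t z) = z"
proof -
  obtain x where x: "solves V t x" "x ` {0..t} \<subseteq> cball 0 N" "x 0 = z"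
    using z by (auto simp: trapped_def)
  have V': "lipschitz_on_balls (\<lambda>z. - V z)"
    using V by (simp add: lipschitz_on_balls_def norm_minus_commute)
  have f: "flowmap V t z = x t" using flowmap_eq[OF V x(1) t] x(3) by simp
  note r = solves_reverse[OF x(1)]
  have "(\<lambda>\<tau>. x (t - \<tau>)) ` {0..t} \<subseteq> cball 0 N" using x(2) by (simp add: image_subset_iff)
  then show "flowmap V t z \<in> trapped (\<lambda>z. - V z) t N"
    unfolding f trapped_def using r by (auto intro!: exI[of _ "\<lambda>\<tau>. x (t - \<tau>)"])
  show "flowmap (\<lambda>z. - V z) t (flowmap V t z) = z"
    using flowmap_eq[OF V' r t] f x(3) by simp
qed

lemma continuous_on_flowmap:
  fixes V :: "'a::real_inner \<Rightarrow> 'a"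
  assumes V: "lipschitz_on_balls V" and t: "0 \<le> t"
  shows "continuous_on (trapped V t N) (flowmap V t)"
proof -
  obtain L where L: "\<And>a b. a \<in> cball 0 N \<Longrightarrow> b \<in> cball 0 N \<Longrightarrow> norm (V a - V b) \<le> L * norm (a - b)"
    using V unfolding lipschitz_on_balls_def by meson
  have "dist (flowmap V t a) (flowmap V t b) \<le> exp (L * t) * dist a b"
    if ab: "a \<in> trapped V t N" "b \<in> trapped V t N" for a b
  proof -
    obtain x y where x: "solves V t x" "x ` {0..t} \<subseteq> cball 0 N" "a = x 0"
      and y: "solves V t y" "y ` {0..t} \<subseteq> cball 0 N" "b = y 0"
      using ab unfolding trapped_def by blast
    show ?thesis
      using gronwall_two_solutions[OF x(1,2) y(1,2) L, of t] t
      by (simp add: x(3) y(3) dist_norm flowmap_eq[OF V _ t] x(1) y(1))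
  qed
  then have "(exp (L * t))-lipschitz_on (trapped V t N) (flowmap V t)"
    by (auto intro!: lipschitz_onI)
  then show ?thesis by (rule lipschitz_on_continuous_on)
qed

text \<open>If initial points converge, the Gronwall bound makes their solutions uniformly Cauchy on
  \<open>{0..t}\<close>. Their velocities then converge uniformly too, so the limit curve is a
  solution, and it stays in the closed ball.\<close>

lemma closed_trapped:
  fixes V :: "'a::euclidean_space \<Rightarrow> 'a"
  assumes V: "lipschitz_on_balls V" and t: "0 \<le> t"
  shows "closed (trapped V t N)"
  unfolding closed_sequential_limits
proof (intro allI impI)
  fix z l assume zl: "(\<forall>n. z n \<in> trapped V t N) \<and> z \<longlonglongrightarrow> l"
  obtain L where L0: "L \<ge> 0" and L: "\<And>a b. a \<in> cball 0 N \<Longrightarrow> b \<in> cball 0 N \<Longrightarrow> norm (V a - V b) \<le> L * norm (a - b)"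
    using V unfolding lipschitz_on_balls_def by meson
  have "\<forall>n. \<exists>x. solves V t x \<and> x ` {0..t} \<subseteq> cball 0 N \<and> x 0 = z n"
    using zl by (auto simp: trapped_def) metis
  then obtain x where x: "\<And>n. solves V t (x n)" "\<And>n. x n ` {0..t} \<subseteq> cball 0 N" "\<And>n. x n 0 = z n"
    by metis
  have bd: "norm (x n \<tau> - x m \<tau>) \<le> exp (L * t) * norm (z n - z m)" if "\<tau> \<in> {0..t}" for n m \<tau>
  proof -
    have "norm (x n \<tau> - x m \<tau>) \<le> exp (L * \<tau>) * norm (x n 0 - x m 0)"
      by (rule gronwall_two_solutions[OF x(1,2) x(1,2) L that])
    also have "\<dots> \<le> exp (L * t) * norm (z n - z m)"
      unfolding x(3) using that L0 by (intro mult_right_mono) (auto intro: mult_left_mono)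
    finally show ?thesis .
  qed
  have cz: "Cauchy z" using zl LIMSEQ_imp_Cauchy by blast
  have uc: "\<exists>M. \<forall>m\<ge>M. \<forall>n\<ge>M. \<forall>\<tau>\<in>{0..t}. norm (x n \<tau> - x m \<tau>) < e" if "e > 0" for e
  proof -
    have "e / exp (L * t) > 0" using that by simp
    then obtain M where M: "\<And>m n. m \<ge> M \<Longrightarrow> n \<ge> M \<Longrightarrow> norm (z m - z n) < e / exp (L * t)"
      using cz by (metis CauchyD)
    show ?thesis
    proof (intro exI[of _ M] allI impI ballI)
      fix m n \<tau> assume mn: "M \<le> m" "M \<le> n" and \<tau>: "\<tau> \<in> {0..t}"
      have "norm (x n \<tau> - x m \<tau>) \<le> exp (L * t) * norm (z n - z m)" using bd[OF \<tau>] .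
      also have "\<dots> < exp (L * t) * (e / exp (L * t))"
        using M[OF mn(2,1)] by (intro mult_strict_left_mono) auto
      finally show "norm (x n \<tau> - x m \<tau>) < e" by simp
    qed
  qed
  have "uniformly_convergent_on {0..t} x"
    unfolding uniformly_convergent_eq_Cauchy uniformly_Cauchy_on_def dist_norm
    using uc by metis
  then obtain y where y: "uniform_limit {0..t} x y sequentially"
    by (auto simp: uniformly_convergent_on_def)
  have yl: "(\<lambda>n. x n \<tau>) \<longlonglongrightarrow> y \<tau>" if "\<tau> \<in> {0..t}" for \<tau>
    using y that by (rule tendsto_uniform_limitI)
  have yN: "y \<tau> \<in> cball 0 N" if "\<tau> \<in> {0..t}" for \<tau>
    by (rule Lim_in_closed_set[OF _ _ _ yl[OF that]]) (use x(2) that in \<open>auto intro!: always_eventually simp: image_subset_iff\<close>)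
  have "\<exists>g. \<forall>\<tau>\<in>{0..t}. (\<lambda>n. x n \<tau>) \<longlonglongrightarrow> g \<tau> \<and> (g has_derivative (\<lambda>h. h *\<^sub>R V (y \<tau>))) (at \<tau> within {0..t})"
  proof (rule has_derivative_sequence)
    show "convex {0..t}" by simp
    show "(x n has_derivative (\<lambda>h. h *\<^sub>R V (x n \<tau>))) (at \<tau> within {0..t})" if "\<tau> \<in> {0..t}" for n \<tau>
      using x(1) that by (simp add: solves_def has_vector_derivative_def)
    show "0 \<in> {0..t}" using t by simp
    show "(\<lambda>n. x n 0) \<longlonglongrightarrow> y 0" using yl t by simp
    fix e :: real assume "e > 0"
    \<comment> \<open>The constant \<open>L + 1\<close> keeps the quotient meaningful when
      \<open>L = 0\<close>.\<close>
    then have "e / (L + 1) > 0" using L0 by simp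
    then have "\<forall>\<^sub>F n in sequentially. \<forall>\<tau>\<in>{0..t}. dist (x n \<tau>) (y \<tau>) < e / (L + 1)"
      using y by (auto simp: uniform_limit_iff)
    then show "\<forall>\<^sub>F n in sequentially. \<forall>\<tau>\<in>{0..t}. \<forall>h. norm (h *\<^sub>R V (x n \<tau>) - h *\<^sub>R V (y \<tau>)) \<le> e * norm h"
    proof eventually_elim
      case (elim n)
      show ?case
      proof (intro ballI allI)
        fix \<tau> h :: real assume \<tau>: "\<tau> \<in> {0..t}"
        have "norm (V (x n \<tau>) - V (y \<tau>)) \<le> L * norm (x n \<tau> - y \<tau>)"
          using x(2) yN \<tau> by (intro L) (auto simp: image_subset_iff)
        also have "\<dots> \<le> (L + 1) * norm (x n \<tau> - y \<tau>)" by (simp add: algebra_simps)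
        also have "\<dots> \<le> (L + 1) * (e / (L + 1))"
          using elim \<tau> L0 by (intro mult_left_mono) (force simp: dist_norm)+
        also have "\<dots> = e" using L0 by simp
        finally show "norm (h *\<^sub>R V (x n \<tau>) - h *\<^sub>R V (y \<tau>)) \<le> e * norm h"
          by (simp add: mult.commute[of e] mult_left_mono flip: scaleR_diff_right)
      qed
    qed
  qed
  then obtain g where g: "\<And>\<tau>. \<tau> \<in> {0..t} \<Longrightarrow> (\<lambda>n. x n \<tau>) \<longlonglongrightarrow> g \<tau>"
     "\<And>\<tau>. \<tau> \<in> {0..t} \<Longrightarrow> (g has_derivative (\<lambda>h. h *\<^sub>R V (y \<tau>))) (at \<tau> within {0..t})" by blast
  \<comment> \<open>The theorem on sequences of derivatives returns its own limit \<open>g\<close>,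
    which is only known to agree with \<open>y\<close> on \<open>{0..t}\<close>; the solution is
    \<open>g\<close>.\<close>
  have gy: "g \<tau> = y \<tau>" if "\<tau> \<in> {0..t}" for \<tau>
    using g(1) yl that LIMSEQ_unique by blast
  have "solves V t g"
    unfolding solves_def has_vector_derivative_def using g(2) gy by simp
  moreover have "g ` {0..t} \<subseteq> cball 0 N" using gy yN by force
  moreover have "g 0 = l" using g(1)[of 0] t x(3) zl LIMSEQ_unique by force
  ultimately show "l \<in> trapped V t N" unfolding trapped_def by blast
qed

section \<open>Euler polygons\<close>

lemma vector_derivative_bound:
  fixes f :: "real \<Rightarrow> 'a::real_normed_vector"
  assumes "\<And>s. s \<in> {a..b} \<Longrightarrow> (f has_vector_derivative f' s) (at s within {a..b})"
    and "\<And>s. s \<in> {a..b} \<Longrightarrow> norm (f' s) \<le> B" and "x \<in> {a..b}" "y \<in> {a..b}"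
  shows "norm (f x - f y) \<le> B * \<bar>x - y\<bar>"
proof -
  have "norm (f x - f y) \<le> B * norm (x - y)"
  proof (rule differentiable_bound[where S="{a..b}" and f'="\<lambda>s h. h *\<^sub>R f' s"])
    fix s assume s: "s \<in> {a..b}"
    show "(f has_derivative (\<lambda>h. h *\<^sub>R f' s)) (at s within {a..b})"
      using assms(1)[OF s] by (simp add: has_vector_derivative_def)
    show "onorm (\<lambda>h. h *\<^sub>R f' s) \<le> B"
      using assms(2)[OF s] by (intro onorm_le) (simp add: mult.commute[of B] mult_left_mono)
  qed (use assms in auto)
  then show ?thesis by simp
qed

definition euler_step :: "('a::real_normed_vector \<Rightarrow> 'a) \<Rightarrow> real \<Rightarrow> 'a \<Rightarrow> 'a" where
  "euler_step V h z = z + h *\<^sub>R V z"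

text \<open>During one step the solution moves by at most \<open>M h\<close>, so its velocity
  changes by at most \<open>L M h\<close>. Integrating this deviation over length \<open>h\<close>
  gives the bound; the mean value inequality is applied to
  \<open>x s - s V (x \<tau>)\<close>.\<close>

lemma euler_local_error:
  fixes V :: "'a::real_normed_vector \<Rightarrow> 'a"
  assumes x: "solves V t x" "x ` {0..t} \<subseteq> S"
    and L: "\<And>a b. a \<in> S \<Longrightarrow> b \<in> S \<Longrightarrow> norm (V a - V b) \<le> L * norm (a - b)" and L0: "L \<ge> 0"
    and M: "\<And>a. a \<in> S \<Longrightarrow> norm (V a) \<le> M" and \<tau>: "0 \<le> \<tau>" "0 \<le> h" "\<tau> + h \<le> t"
  shows "norm (x (\<tau> + h) - euler_step V h (x \<tau>)) \<le> L * M * h\<^sup>2"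
proof -
  have sub: "{\<tau>..\<tau> + h} \<subseteq> {0..t}" using \<tau> by auto
  have xS: "x s \<in> S" if "s \<in> {\<tau>..\<tau> + h}" for s using x(2) sub that by blast
  have x': "(x has_vector_derivative V (x s)) (at s within {\<tau>..\<tau> + h})" if "s \<in> {\<tau>..\<tau> + h}" for s
    using x(1) sub that unfolding solves_def by (blast intro: has_vector_derivative_within_subset)
  have M0: "M \<ge> 0" using order_trans[OF norm_ge_zero M[OF xS[of \<tau>]]] \<tau> by simp
  have near: "norm (x s - x \<tau>) \<le> M * h" if s: "s \<in> {\<tau>..\<tau> + h}" for s
  proof -
    have "norm (x s - x \<tau>) \<le> M * \<bar>s - \<tau>\<bar>"
      by (rule vector_derivative_bound[OF x']) (use M xS s \<tau> in auto)
    also have "\<dots> \<le> M * h" using s M0 by (intro mult_left_mono) auto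
    finally show ?thesis .
  qed
  define y where "y s = x s - s *\<^sub>R V (x \<tau>)" for s
  have "norm (y (\<tau> + h) - y \<tau>) \<le> L * (M * h) * \<bar>\<tau> + h - \<tau>\<bar>"
  proof (rule vector_derivative_bound[where f'="\<lambda>s. V (x s) - V (x \<tau>)"])
    fix s assume s: "s \<in> {\<tau>..\<tau> + h}"
    show "(y has_vector_derivative V (x s) - V (x \<tau>)) (at s within {\<tau>..\<tau> + h})"
      unfolding y_def using x'[OF s] by (auto intro!: derivative_eq_intros)
    have "norm (V (x s) - V (x \<tau>)) \<le> L * norm (x s - x \<tau>)" using s \<tau> by (intro L xS) auto
    also have "\<dots> \<le> L * (M * h)" using near[OF s] L0 by (intro mult_left_mono)
    finally show "norm (V (x s) - V (x \<tau>)) \<le> L * (M * h)" .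
  qed (use \<tau> in auto)
  moreover have "y (\<tau> + h) - y \<tau> = x (\<tau> + h) - euler_step V h (x \<tau>)"
    by (simp add: y_def euler_step_def algebra_simps)
  ultimately show ?thesis using \<tau> by (simp add: power2_eq_square mult.assoc)
qed

text \<open>The polygon may leave the ball that contains the solution, so the constants
  \<open>L\<close> and \<open>M\<close> are taken on a ball larger by 1. The hypothesis
  \<open>small\<close> keeps the error below 1, hence the polygon inside that ball, and this lets
  the induction on the steps close.\<close>

lemma euler_global_error:
  fixes V :: "'a::real_normed_vector \<Rightarrow> 'a"
  assumes x: "solves V t x" "x ` {0..t} \<subseteq> cball 0 N"
    and L: "\<And>a b. a \<in> cball 0 (N + 1) \<Longrightarrow> b \<in> cball 0 (N + 1) \<Longrightarrow> norm (V a - V b) \<le> L * norm (a - b)"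
    and L0: "L \<ge> 0" and M: "\<And>a. a \<in> cball 0 (N + 1) \<Longrightarrow> norm (V a) \<le> M" and M0: "M \<ge> 0"
    and h: "0 \<le> h" and kt: "real k * h \<le> t" and small: "t * exp (L * t) * L * M * h \<le> 1"
  shows "norm ((euler_step V h ^^ k) (x 0) - x (real k * h)) \<le> t * exp (L * t) * L * M * h"
    and "(euler_step V h ^^ k) (x 0) \<in> cball 0 (N + 1)"
proof -
  define E where "E k = norm ((euler_step V h ^^ k) (x 0) - x (real k * h))" for k
  \<comment> \<open>A crude majorant for the recursion
    \<open>E (k + 1) \<le> (1 + h L) E k + L M h^2\<close> with \<open>E 0 = 0\<close>: each of the
    \<open>k\<close> local errors is amplified by the full factor.\<close>
  define B where "B k = real k * (L * M * h\<^sup>2) * (1 + h * L) ^ k" for k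
  have B: "B k \<le> t * exp (L * t) * L * M * h" if kt: "real k * h \<le> t" for k
  proof -
    have "(1 + h * L) ^ k \<le> exp (h * L) ^ k"
      using h L0 by (intro power_mono exp_ge_add_one_self) auto
    also have "\<dots> = exp (real k * (h * L))" by (simp add: exp_of_nat_mult)
    also have "\<dots> = exp ((real k * h) * L)" by (simp add: mult.assoc)
    also have "\<dots> \<le> exp (t * L)" using kt L0 by (simp add: mult_right_mono)
    finally have 1: "(1 + h * L) ^ k \<le> exp (L * t)" by (simp add: mult.commute)
    have "B k = (real k * h) * (L * M * h) * (1 + h * L) ^ k" by (simp add: B_def power2_eq_square)
    also have "\<dots> \<le> t * (L * M * h) * exp (L * t)"
      using 1 kt h L0 M0 order_trans[OF _ kt, of 0] by (intro mult_mono) auto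
    finally show ?thesis by (simp add: mult_ac)
  qed
  have xin: "x (real k * h) \<in> cball 0 N" if "real k * h \<le> t" for k
    using x(2) that h by (auto simp: image_subset_iff)
  \<comment> \<open>Membership in the larger ball at step \<open>k\<close> must come from the error
    bound at step \<open>k\<close>, before \<open>V\<close> can be compared at the polygon and the
    solution for step \<open>k + 1\<close>.\<close>
  have inb: "(euler_step V h ^^ k) (x 0) \<in> cball 0 (N + 1)" if "real k * h \<le> t" "E k \<le> B k" for k
  proof -
    have "norm ((euler_step V h ^^ k) (x 0)) \<le> E k + norm (x (real k * h))"
      unfolding E_def by (metis diff_add_cancel norm_triangle_ineq)
    then show ?thesis using xin[OF that(1)] B[OF that(1)] that small by simp
  qed
  have EB: "real k * h \<le> t \<Longrightarrow> E k \<le> B k" for k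
  proof (induction k)
    case 0 show ?case by (simp add: E_def B_def)
  next
    case (Suc k)
    have kt: "real k * h + h \<le> t" using Suc.prems by (simp add: algebra_simps)
    then have kt': "real k * h \<le> t" using h by simp
    let ?y = "(euler_step V h ^^ k) (x 0)" and ?x = "x (real k * h)"
    note IH = Suc.IH[OF kt']
    have y: "?y \<in> cball 0 (N + 1)" by (rule inb[OF kt' IH])
    have xb: "?x \<in> cball 0 (N + 1)" using xin[OF kt'] by simp
    have loc: "norm (x (real k * h + h) - euler_step V h ?x) \<le> L * M * h\<^sup>2"
      by (rule euler_local_error[OF x(1), where S="cball 0 (N+1)"])
        (use x(2) L L0 M h kt in \<open>force simp: image_subset_iff\<close>)+
    have "E (Suc k) = norm (euler_step V h ?y - x (real k * h + h))"
      by (simp add: E_def algebra_simps)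
    also have "\<dots> = norm ((?y - ?x) + h *\<^sub>R (V ?y - V ?x) - (x (real k * h + h) - euler_step V h ?x))"
      by (simp add: euler_step_def algebra_simps)
    also have "\<dots> \<le> norm (?y - ?x) + norm (h *\<^sub>R (V ?y - V ?x)) + norm (x (real k * h + h) - euler_step V h ?x)"
      by (meson norm_triangle_ineq norm_triangle_ineq4 order_trans add_right_mono)
    also have "\<dots> \<le> E k + h * (L * E k) + L * M * h\<^sup>2"
      using loc L[OF y xb] h by (auto simp: E_def intro!: add_mono mult_left_mono)
    also have "\<dots> = (1 + h * L) * E k + L * M * h\<^sup>2" by (simp add: algebra_simps)
    also have "\<dots> \<le> (1 + h * L) * B k + L * M * h\<^sup>2"
      using IH h L0 by (intro add_right_mono mult_left_mono) auto
    also have "\<dots> = (1 + h * L) ^ Suc k * (real k * (L * M * h\<^sup>2)) + 1 * (L * M * h\<^sup>2)"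
      by (simp add: B_def)
    also have "\<dots> \<le> (1 + h * L) ^ Suc k * (real k * (L * M * h\<^sup>2)) + (1 + h * L) ^ Suc k * (L * M * h\<^sup>2)"
      using h L0 M0 by (intro add_left_mono mult_right_mono one_le_power) auto
    also have "\<dots> = B (Suc k)" by (simp add: B_def algebra_simps)
    finally show ?case .
  qed
  show "norm ((euler_step V h ^^ k) (x 0) - x (real k * h)) \<le> t * exp (L * t) * L * M * h"
    using EB[OF kt] B[OF kt] by (simp add: E_def)
  show "(euler_step V h ^^ k) (x 0) \<in> cball 0 (N + 1)"
    by (rule inb[OF kt EB[OF kt]])
qed

section \<open>Liouville's theorem\<close>

text \<open>A one-sided estimate suffices: used for \<open>V\<close> and for \<open>- V\<close> it gives equality.\<close>

definition nearly_expanding :: "('a::euclidean_space \<Rightarrow> 'a) \<Rightarrow> 'a measure \<Rightarrow> bool" where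
  "nearly_expanding V \<mu> \<longleftrightarrow> (\<forall>N. \<forall>\<epsilon>>0. \<exists>\<delta>>0. \<forall>h K. 0 < h \<and> h < \<delta> \<and> compact K \<and> K \<subseteq> cball 0 N \<longrightarrow>
     ennreal (1 - \<epsilon> * h) * emeasure \<mu> K \<le> emeasure \<mu> (euler_step V h ` K))"

text \<open>After \<open>n\<close> Euler steps of size \<open>t / n\<close> the image of
  \<open>K\<close> has measure at least \<open>(1 - \<epsilon> h)^n\<close>, hence
  \<open>1 - \<epsilon> t\<close>, times that of \<open>K\<close>. For large \<open>n\<close> it
  lies in any given open neighbourhood \<open>U\<close> of the compact flow image \<open>W\<close>.
  Letting \<open>\<epsilon>\<close> tend to 0 and then shrinking \<open>U\<close> to
  \<open>W\<close> by outer regularity gives the claim.\<close>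

lemma emeasure_flowmap_compact_ge:
  fixes V :: "'a::euclidean_space \<Rightarrow> 'a"
  assumes V: "lipschitz_on_balls V" and sets: "sets \<mu> = sets borel"
    and fin: "\<And>N. emeasure \<mu> (cball 0 N) < \<infinity>" and step: "nearly_expanding V \<mu>"
    and t: "0 \<le> t" and K: "compact K" "K \<subseteq> trapped V t N"
  shows "emeasure \<mu> K \<le> emeasure \<mu> (flowmap V t ` K)"
\<comment> \<open>The general argument divides by \<open>t\<close> and separates the nonempty
  compact set \<open>W\<close> from the complement of \<open>U\<close>.\<close>
proof (cases "t = 0 \<or> K = {}")
  case True
  have "flowmap V t z = z" if "z \<in> K" "t = 0" for z
    using K(2) that flowmap_eq[OF V _ t] unfolding trapped_def by auto
  then show ?thesis using True by force
next
  case False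
  then have t0: "t > 0" and Kne: "K \<noteq> {}" using t by auto
  define W where "W = flowmap V t ` K"
  have W: "compact W" "W \<noteq> {}"
    unfolding W_def using K Kne continuous_on_flowmap[OF V t]
    by (auto intro!: compact_continuous_image intro: continuous_on_subset)
  have [measurable]: "cball 0 r \<in> sets \<mu>" for r :: real using sets by simp
  \<comment> \<open>Truncation makes the measure finite, as regularity requires. The ball of radius
    \<open>N + 1\<close> contains all Euler images of \<open>K\<close>, so their measure is
    unaffected.\<close>
  define \<nu> where "\<nu> = density \<mu> (indicator (cball 0 (N + 1)))"
  have \<nu>: "emeasure \<nu> A = emeasure \<mu> (cball 0 (N + 1) \<inter> A)" if "A \<in> sets borel" for A
    unfolding \<nu>_def using that sets by (intro emeasure_restricted) auto
  have sets\<nu>: "sets \<nu> = sets borel" using sets by (simp add: \<nu>_def)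
  have space: "space \<mu> = UNIV" using sets_eq_imp_space_eq[OF sets] by simp
  have "emeasure \<nu> (space \<nu>) \<noteq> \<infinity>"
    using \<nu>[of UNIV] fin[of "N+1"] space by (simp add: \<nu>_def)
  note outer = outer_regular[OF sets\<nu> this, of W]
  have KN: "K \<subseteq> cball 0 N" using K(2) trapped_subset[OF t] by blast
  have finK: "emeasure \<mu> K < \<infinity>"
    using emeasure_mono[OF KN, of \<mu>] fin[of N] by (auto simp: less_top[symmetric] top_unique)
  obtain L where L0: "L \<ge> 0" and L: "\<And>a b. a \<in> cball 0 (N+1) \<Longrightarrow> b \<in> cball 0 (N+1) \<Longrightarrow> norm (V a - V b) \<le> L * norm (a - b)"
    using V unfolding lipschitz_on_balls_def by meson
  have contV: "continuous_on (cball 0 (N+1)) V"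
    by (rule lipschitz_on_continuous_on[of L]) (use L0 L in \<open>auto intro!: lipschitz_onI simp: dist_norm\<close>)
  then have "bounded (V ` cball 0 (N+1))"
    by (intro compact_imp_bounded compact_continuous_image) auto
  then obtain M where M0: "M > 0" and M: "\<And>a. a \<in> cball 0 (N+1) \<Longrightarrow> norm (V a) \<le> M"
    by (auto simp: bounded_pos)
  have main: "emeasure \<mu> K \<le> emeasure \<nu> U" if U: "W \<subseteq> U" "open U" for U
  proof -
    obtain e where e: "e > 0" "{x. infdist x W \<le> e} \<subseteq> U"
      using compact_in_open_separated[OF W(2,1) U(2,1)] .
    have Ub: "U \<in> sets borel" using U by simp
    have approx: "ennreal (1 - \<epsilon> * t) * emeasure \<mu> K \<le> emeasure \<nu> U" if \<epsilon>: "\<epsilon> > 0" "\<epsilon> * t < 1" for \<epsilon>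
    proof -
      obtain \<delta> where \<delta>: "\<delta> > 0" "\<forall>h K. 0 < h \<and> h < \<delta> \<and> compact K \<and> K \<subseteq> cball 0 (N+1) \<longrightarrow>
          ennreal (1 - \<epsilon> * h) * emeasure \<mu> K \<le> emeasure \<mu> (euler_step V h ` K)"
        using step \<epsilon>(1) unfolding nearly_expanding_def by blast
      define C where "C = t * exp (L * t) * L * M"
      have C0: "C \<ge> 0" using t L0 M0 by (simp add: C_def)
      \<comment> \<open>The three bounds yield \<open>h < \<delta>\<close> for the step estimate,
        \<open>C h \<le> 1\<close> to keep the polygons in the larger ball, and
        \<open>C h \<le> e\<close> to bring their endpoints within \<open>e\<close> of
        \<open>W\<close>.\<close>
      obtain n :: nat where n: "real n > max (t / \<delta>) (max (C * t) (C * t / e))"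
        using reals_Archimedean2 by blast
      then have n': "real n > t / \<delta>" "real n > C * t" "real n > C * t / e" by auto
      have npos: "real n > 0" using n'(1) t0 \<delta>(1) by (meson divide_pos_pos less_trans)
      define h where "h = t / real n"
      have h: "0 < h" "h < \<delta>" "C * h \<le> 1" "C * h \<le> e" "real n * h = t"
        using n' npos t0 \<delta>(1) e(1) by (auto simp: h_def field_simps)
      have hh: "h \<le> t" using npos t0 by (simp add: h_def field_simps)
      have eh: "0 \<le> 1 - \<epsilon> * h" using mult_left_mono[OF hh less_imp_le[OF \<epsilon>(1)]] \<epsilon>(2) by linarith
      have inball: "(euler_step V h ^^ k) ` K \<subseteq> cball 0 (N+1)"
        and close: "k = n \<Longrightarrow> (euler_step V h ^^ k) ` K \<subseteq> U" if "k \<le> n" for k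
      proof -
        have kt: "real k * h \<le> t" unfolding h(5)[symmetric] using that h(1) by simp
        have *: "(euler_step V h ^^ k) z \<in> cball 0 (N+1) \<and> (k = n \<longrightarrow> (euler_step V h ^^ k) z \<in> U)" if "z \<in> K" for z
        proof -
          obtain x where x: "solves V t x" "x ` {0..t} \<subseteq> cball 0 N" "x 0 = z"
            using K(2) \<open>z \<in> K\<close> unfolding trapped_def by blast
          note err = euler_global_error[OF x(1,2) L L0 M less_imp_le[OF M0] less_imp_le[OF h(1)] kt h(3)[unfolded C_def],
              unfolded x(3)]
          have "k = n \<Longrightarrow> dist ((euler_step V h ^^ k) z) (flowmap V t z) \<le> e"
            using err(1) h(4,5) flowmap_eq[OF V x(1) t] x(3) by (simp add: dist_norm C_def)
          then have "k = n \<Longrightarrow> infdist ((euler_step V h ^^ k) z) W \<le> e"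
            using \<open>z \<in> K\<close> unfolding W_def by (meson imageI infdist_le2)
          then show ?thesis using err(2) e(2) by auto
        qed
        then show "(euler_step V h ^^ k) ` K \<subseteq> cball 0 (N+1)"
          and "k = n \<Longrightarrow> (euler_step V h ^^ k) ` K \<subseteq> U" by blast+
      qed
      have iter: "k \<le> n \<Longrightarrow> compact ((euler_step V h ^^ k) ` K) \<and>
          ennreal ((1 - \<epsilon> * h) ^ k) * emeasure \<mu> K \<le> emeasure \<mu> ((euler_step V h ^^ k) ` K)" for k
      proof (induction k)
        case 0 then show ?case using K by simp
      next
        case (Suc k)
        let ?I = "(euler_step V h ^^ k) ` K"
        have I: "compact ?I" "?I \<subseteq> cball 0 (N+1)" and
          IH: "ennreal ((1 - \<epsilon> * h) ^ k) * emeasure \<mu> K \<le> emeasure \<mu> ?I"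
          using Suc inball[of k] by auto
        have eq: "(euler_step V h ^^ Suc k) ` K = euler_step V h ` ?I" by (simp add: image_comp)
        have "continuous_on (cball 0 (N+1)) (euler_step V h)"
          unfolding euler_step_def by (intro continuous_intros contV)
        then have "compact (euler_step V h ` ?I)"
          by (rule compact_continuous_image[OF continuous_on_subset[OF _ I(2)] I(1)])
        moreover have "ennreal ((1 - \<epsilon> * h) ^ Suc k) * emeasure \<mu> K
            = ennreal (1 - \<epsilon> * h) * (ennreal ((1 - \<epsilon> * h) ^ k) * emeasure \<mu> K)"
          using eh by (simp add: ennreal_mult mult.assoc)
        moreover have "\<dots> \<le> ennreal (1 - \<epsilon> * h) * emeasure \<mu> ?I" by (rule mult_left_mono[OF IH]) simp
        moreover have "\<dots> \<le> emeasure \<mu> (euler_step V h ` ?I)" using \<delta>(2) h(1,2) I by blast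
        ultimately show ?case unfolding eq by auto
      qed
      let ?I = "(euler_step V h ^^ n) ` K"
      have "1 - \<epsilon> * t = 1 + real n * (- (\<epsilon> * h))" using h(5) by (simp add: algebra_simps)
      also have "\<dots> \<le> (1 - \<epsilon> * h) ^ n" using Bernoulli_inequality[of "- (\<epsilon> * h)" n] eh by simp
      finally have "ennreal (1 - \<epsilon> * t) * emeasure \<mu> K \<le> ennreal ((1 - \<epsilon> * h) ^ n) * emeasure \<mu> K"
        by (intro mult_right_mono ennreal_leI) auto
      also have "\<dots> \<le> emeasure \<mu> ?I" using iter[of n] by simp
      also have "\<dots> \<le> emeasure \<mu> (cball 0 (N+1) \<inter> U)"
        using inball[of n] close[of n] Ub sets by (intro emeasure_mono) auto
      finally show ?thesis using \<nu>[OF Ub] by simp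
    qed
    have finU: "emeasure \<nu> U < \<infinity>"
    proof -
      have "emeasure \<nu> U \<le> emeasure \<mu> (cball 0 (N+1))"
        unfolding \<nu>[OF Ub] by (intro emeasure_mono) auto
      then show ?thesis using fin[of "N+1"] le_less_trans by blast
    qed
    define mK mU where "mK = measure \<mu> K" and "mU = measure \<nu> U"
    have mK: "emeasure \<mu> K = ennreal mK" and mU: "emeasure \<nu> U = ennreal mU"
      using finK finU by (auto simp: mK_def mU_def emeasure_eq_ennreal_measure less_top)
    have mK0: "mK \<ge> 0" and mU0: "mU \<ge> 0" by (auto simp: mK_def mU_def)
    have "mK \<le> mU"
    proof (rule field_le_epsilon)
      fix \<eta> :: real assume \<eta>: "\<eta> > 0"
      \<comment> \<open>The first entry makes the loss \<open>\<epsilon> t mK\<close> at most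
        \<open>\<eta>\<close>, with \<open>mK + 1\<close> in place of \<open>mK\<close> in case
        \<open>K\<close> is null; the second gives \<open>\<epsilon> t \<le> 1/2\<close>.\<close>
      define \<epsilon> where "\<epsilon> = min (\<eta> / ((mK + 1) * t)) (1 / (2 * t))"
      have \<epsilon>: "\<epsilon> > 0" "\<epsilon> * t < 1" "\<epsilon> * t * (mK + 1) \<le> \<eta>"
      proof -
        show "\<epsilon> > 0" using \<eta> mK0 t0 by (simp add: \<epsilon>_def)
        have "\<epsilon> * t \<le> 1 / (2 * t) * t" using t0 by (intro mult_right_mono) (auto simp: \<epsilon>_def)
        then show "\<epsilon> * t < 1" using t0 by simp
        have "\<epsilon> * (t * (mK + 1)) \<le> \<eta> / ((mK + 1) * t) * (t * (mK + 1))"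
          using t0 mK0 by (intro mult_right_mono) (auto simp: \<epsilon>_def)
        then show "\<epsilon> * t * (mK + 1) \<le> \<eta>" using t0 mK0 by (simp add: mult_ac)
      qed
      have "(1 - \<epsilon> * t) * mK \<le> mU"
        using approx[OF \<epsilon>(1,2)] \<epsilon>(2) mK0 mU0 unfolding mK mU by (simp flip: ennreal_mult)
      then have "mK \<le> mU + \<epsilon> * t * mK" by (simp add: algebra_simps)
      also have "\<epsilon> * t * mK \<le> \<eta>" using \<epsilon> t0 by (simp add: algebra_simps) (smt (verit) mult_pos_pos)
      finally show "mK \<le> mU + \<eta>" by simp
    qed
    then show ?thesis unfolding mK mU by (rule ennreal_leI)
  qed
  have "emeasure \<mu> K \<le> emeasure \<nu> W"
    using W(1) unfolding outer[OF borel_closed[OF compact_imp_closed[OF W(1)]]]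
    by (intro INF_greatest) (use main in auto)
  also have "\<dots> \<le> emeasure \<mu> W"
    using W(1) sets by (subst \<nu>) (auto intro!: emeasure_mono borel_closed compact_imp_closed)
  finally show ?thesis by (simp add: W_def)
qed

text \<open>The image is the preimage of \<open>A\<close> under the reversed flow map, which is
  continuous on a closed set.\<close>

lemma flowmap_image_borel:
  fixes V :: "'a::euclidean_space \<Rightarrow> 'a"
  assumes V: "lipschitz_on_balls V" and t: "0 \<le> t" and A: "A \<in> sets borel" "A \<subseteq> trapped V t N"
  shows "flowmap V t ` A \<in> sets borel"
proof -
  have V': "lipschitz_on_balls (\<lambda>z. - V z)"
    using V by (simp add: lipschitz_on_balls_def norm_minus_commute)
  let ?T = "trapped (\<lambda>z. - V z) t N" and ?g = "flowmap (\<lambda>z. - V z) t"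
  have T: "?T \<in> sets borel"
    by (intro borel_closed closed_trapped V' t)
  have g: "?g \<in> borel_measurable (restrict_space borel ?T)"
    by (intro borel_measurable_continuous_on_restrict continuous_on_flowmap V' t)
  have "flowmap V t ` A = ?g -` A \<inter> ?T"
  proof (intro equalityI subsetI)
    fix y assume "y \<in> flowmap V t ` A"
    then show "y \<in> ?g -` A \<inter> ?T" using A(2) flowmap_reverse[OF V t] by auto
  next
    fix y assume y: "y \<in> ?g -` A \<inter> ?T"
    then have "flowmap V t (?g y) = y" using flowmap_reverse(2)[OF V' t, of y N] by simp
    then show "y \<in> flowmap V t ` A" using y by (auto intro!: image_eqI[where x="?g y"])
  qed
  also have "\<dots> \<in> sets (restrict_space borel ?T)"
    using measurable_sets[OF g A(1)] by (simp add: space_restrict_space)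
  finally show ?thesis using T by (auto simp: sets_restrict_space)
qed

text \<open>Inner regularity reduces the Borel set to its compact subsets; truncation to the ball of
  radius \<open>N\<close>, which contains \<open>A\<close>, again provides finiteness.\<close>

lemma emeasure_flowmap_ge:
  fixes V :: "'a::euclidean_space \<Rightarrow> 'a"
  assumes V: "lipschitz_on_balls V" and sets: "sets \<mu> = sets borel"
    and fin: "\<And>N. emeasure \<mu> (cball 0 N) < \<infinity>" and step: "nearly_expanding V \<mu>"
    and t: "0 \<le> t" and A: "A \<in> sets borel" "A \<subseteq> trapped V t N"
  shows "emeasure \<mu> A \<le> emeasure \<mu> (flowmap V t ` A)"
proof -
  have [measurable]: "cball 0 r \<in> sets \<mu>" for r :: real using sets by simp
  define \<nu> where "\<nu> = density \<mu> (indicator (cball 0 N))"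
  have \<nu>: "emeasure \<nu> A = emeasure \<mu> (cball 0 N \<inter> A)" if "A \<in> sets borel" for A
    unfolding \<nu>_def using that sets by (intro emeasure_restricted) auto
  have sets\<nu>: "sets \<nu> = sets borel" using sets by (simp add: \<nu>_def)
  have space: "space \<mu> = UNIV" using sets_eq_imp_space_eq[OF sets] by simp
  have "emeasure \<nu> (space \<nu>) \<noteq> \<infinity>"
    using \<nu>[of UNIV] fin[of "N"] space by (simp add: \<nu>_def)
  note inner = inner_regular[OF sets\<nu> this A(1)]
  have AN: "A \<subseteq> cball 0 N" using A(2) trapped_subset[OF t] by blast
  then have "cball 0 N \<inter> A = A" by blast
  then have "emeasure \<mu> A = emeasure \<nu> A" using \<nu>[OF A(1)] by simp
  also have "\<dots> \<le> emeasure \<mu> (flowmap V t ` A)"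
    unfolding inner
  proof (rule SUP_least)
    fix K assume "K \<in> {K. K \<subseteq> A \<and> compact K}"
    then have K: "K \<subseteq> A" "compact K" by auto
    have "emeasure \<nu> K \<le> emeasure \<mu> K"
      using K sets by (subst \<nu>) (auto intro!: emeasure_mono borel_closed compact_imp_closed)
    also have "\<dots> \<le> emeasure \<mu> (flowmap V t ` K)"
      by (rule emeasure_flowmap_compact_ge[OF V sets fin step t K(2)]) (use K A in blast)
    also have "\<dots> \<le> emeasure \<mu> (flowmap V t ` A)"
      using K flowmap_image_borel[OF V t A] sets by (intro emeasure_mono) auto
    finally show "emeasure \<nu> K \<le> emeasure \<mu> (flowmap V t ` A)" .
  qed
  finally show ?thesis .
qed

lemma emeasure_flowmap_eq:
  fixes V :: "'a::euclidean_space \<Rightarrow> 'a"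
  assumes V: "lipschitz_on_balls V" and sets: "sets \<mu> = sets borel"
    and fin: "\<And>N. emeasure \<mu> (cball 0 N) < \<infinity>"
    and step: "nearly_expanding V \<mu>" "nearly_expanding (\<lambda>z. - V z) \<mu>"
    and t: "0 \<le> t" and A: "A \<in> sets borel" "A \<subseteq> trapped V t N"
  shows "emeasure \<mu> (flowmap V t ` A) = emeasure \<mu> A"
proof (rule antisym)
  have V': "lipschitz_on_balls (\<lambda>z. - V z)"
    using V by (simp add: lipschitz_on_balls_def norm_minus_commute)
  have "flowmap (\<lambda>z. - V z) t ` flowmap V t ` A = A"
    using flowmap_reverse(2)[OF V t] A(2) by (force simp: image_image)
  moreover have "flowmap V t ` A \<subseteq> trapped (\<lambda>z. - V z) t N"
    using flowmap_reverse(1)[OF V t] A(2) by blast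
  ultimately show "emeasure \<mu> (flowmap V t ` A) \<le> emeasure \<mu> A"
    using emeasure_flowmap_ge[OF V' sets fin step(2) t flowmap_image_borel[OF V t A]] by simp
qed (rule emeasure_flowmap_ge[OF V sets fin step(1) t A])

lemma flow_reach_nonneg_iff:
  assumes "0 \<le> t"
  shows "flow_reach V t z y \<longleftrightarrow> (\<exists>x. solves V t x \<and> x 0 = z \<and> x t = y)"
  using assms unfolding flow_reach_def solves_def by (auto simp: closed_segment_eq_real_ivl)

lemma flow_reach_neg_iff:
  assumes "t \<le> 0"
  shows "flow_reach V t z y \<longleftrightarrow> flow_reach (\<lambda>z. - V z) (- t) z y"
proof -
  \<comment> \<open>One implication, proved for every field and time, suffices: the converse is its
    instance for \<open>- V\<close> and \<open>- t\<close>.\<close>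
  have *: "flow_reach (\<lambda>z. - V z) (- t) z y" if reach: "flow_reach V t z y" for V :: "'a \<Rightarrow> 'a" and t
  proof -
    obtain x where x: "x 0 = z" "x t = y"
      "\<And>\<tau>. \<tau> \<in> closed_segment 0 t \<Longrightarrow> (x has_vector_derivative V (x \<tau>)) (at \<tau> within closed_segment 0 t)"
      using reach unfolding flow_reach_def by blast
    have seg: "uminus ` closed_segment 0 (- t) = closed_segment 0 t"
      using closed_segment_linear_image[of "uminus :: real \<Rightarrow> real" 0 "- t"]
      by (simp add: linear_iff)
    have "((\<lambda>s. x (- s)) has_vector_derivative - V (x (- \<tau>))) (at \<tau> within closed_segment 0 (- t))"
      if "\<tau> \<in> closed_segment 0 (- t)" for \<tau>
    proof -
      have 1: "(uminus has_vector_derivative -1) (at \<tau> within closed_segment 0 (- t))"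
        by (auto intro!: derivative_eq_intros)
      have "- \<tau> \<in> closed_segment 0 t" using that seg by blast
      then have 2: "(x has_vector_derivative V (x (- \<tau>))) (at (- \<tau>) within uminus ` closed_segment 0 (- t))"
        unfolding seg by (rule x(3))
      show ?thesis using vector_diff_chain_within[OF 1 2] by (simp add: o_def)
    qed
    then show ?thesis unfolding flow_reach_def using x(1,2) by (intro exI[of _ "\<lambda>s. x (- s)"]) auto
  qed
  show ?thesis using *[of V t] *[of "\<lambda>z. - V z" "- t"] by auto
qed

text \<open>The solutions starting in \<open>A\<close> need not be uniformly bounded, but each one
  is bounded on the compact interval \<open>{0..t}\<close>. The sets
  \<open>A \<inter> trapped V t k\<close> therefore increase to \<open>A\<close>, and both measures
  are continuous along the two increasing unions.\<close>

lemma emeasure_flow_reach_nonneg: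
  fixes V :: "'a::euclidean_space \<Rightarrow> 'a"
  assumes V: "lipschitz_on_balls V" and sets: "sets \<mu> = sets borel"
    and fin: "\<And>N. emeasure \<mu> (cball 0 N) < \<infinity>"
    and step: "nearly_expanding V \<mu>" "nearly_expanding (\<lambda>z. - V z) \<mu>"
    and t: "0 \<le> t" and A: "A \<in> sets borel" "A \<subseteq> {z. \<exists>y. flow_reach V t z y}"
  shows "emeasure \<mu> {y. \<exists>z\<in>A. flow_reach V t z y} = emeasure \<mu> A"
proof -
  define B where "B k = A \<inter> trapped V t (real k)" for k :: nat
  have B: "B k \<in> sets borel" "B k \<subseteq> trapped V t (real k)" for k
    unfolding B_def using A(1) closed_trapped[OF V t, of "real k"] by auto
  have reach: "flow_reach V t z y \<longleftrightarrow> (\<exists>k. z \<in> trapped V t (real k)) \<and> y = flowmap V t z" for z y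
  proof
    assume "flow_reach V t z y"
    then obtain x where x: "solves V t x" "x 0 = z" "x t = y" by (auto simp: flow_reach_nonneg_iff[OF t])
    obtain k :: nat where "x ` {0..t} \<subseteq> cball 0 (real k)" using solves_bounded[OF x(1)] .
    then have "z \<in> trapped V t (real k)" unfolding trapped_def using x(1,2) by blast
    then show "(\<exists>k. z \<in> trapped V t (real k)) \<and> y = flowmap V t z"
      using flowmap_eq[OF V x(1) t] x(2,3) by auto
  next
    assume r: "(\<exists>k. z \<in> trapped V t (real k)) \<and> y = flowmap V t z"
    then obtain x where x: "solves V t x" "x 0 = z" unfolding trapped_def by blast
    then show "flow_reach V t z y"
      using r flowmap_eq[OF V x(1) t] unfolding flow_reach_nonneg_iff[OF t] by auto
  qed
  have "\<exists>k. z \<in> trapped V t (real k)" if "z \<in> A" for z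
    using A(2) that by (auto simp: reach)
  then have AB: "A = (\<Union>k. B k)" unfolding B_def by blast
  have im: "{y. \<exists>z\<in>A. flow_reach V t z y} = (\<Union>k. flowmap V t ` B k)"
    unfolding reach B_def by blast
  have inc: "incseq B"
    unfolding B_def incseq_def by (auto intro: trapped_mono[THEN subsetD, rotated])
  have inc': "incseq (\<lambda>k. flowmap V t ` B k)"
    using inc unfolding incseq_def by blast
  have "emeasure \<mu> (\<Union>k. flowmap V t ` B k) = (SUP k. emeasure \<mu> (flowmap V t ` B k))"
    using flowmap_image_borel[OF V t B] sets inc' by (intro SUP_emeasure_incseq[symmetric]) auto
  also have "\<dots> = (SUP k. emeasure \<mu> (B k))"
    by (intro SUP_cong refl emeasure_flowmap_eq[OF V sets fin step t B])
  also have "\<dots> = emeasure \<mu> (\<Union>k. B k)"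
    using B sets inc by (intro SUP_emeasure_incseq) auto
  finally show ?thesis unfolding im AB[symmetric] .
qed

theorem invariant_measureI:
  fixes V :: "'a::euclidean_space \<Rightarrow> 'a" and \<rho> :: "'a \<Rightarrow> real"
  assumes V: "lipschitz_on_balls V"
    and fin: "\<And>N. emeasure (density lborel (\<lambda>z. ennreal (\<rho> z))) (cball 0 N) < \<infinity>"
    and step: "nearly_expanding V (density lborel (\<lambda>z. ennreal (\<rho> z)))"
       "nearly_expanding (\<lambda>z. - V z) (density lborel (\<lambda>z. ennreal (\<rho> z)))"
  shows "invariant_measure V \<rho>"
  unfolding invariant_measure_def
proof (intro allI impI)
  fix t A assume A: "A \<in> sets borel \<and> A \<subseteq> {z. \<exists>y. flow_reach V t z y}"
  let ?\<mu> = "density lborel (\<lambda>z. ennreal (\<rho> z))"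
  have V': "lipschitz_on_balls (\<lambda>z. - V z)"
    using V by (simp add: lipschitz_on_balls_def norm_minus_commute)
  have sets: "sets ?\<mu> = sets borel" by simp
  show "emeasure ?\<mu> {y. \<exists>z\<in>A. flow_reach V t z y} = emeasure ?\<mu> A"
  proof (cases "0 \<le> t")
    case True
    then show ?thesis using emeasure_flow_reach_nonneg[OF V sets fin step, of t A] A by simp
  next
    case False
    then have t: "0 \<le> - t" "t \<le> 0" by auto
    show ?thesis
      unfolding flow_reach_neg_iff[OF t(2)]
      by (rule emeasure_flow_reach_nonneg[OF V' sets fin step(2) _ t(1)])
        (use step(1) A in \<open>auto simp: flow_reach_neg_iff[OF t(2)]\<close>)
  qed
qed

section \<open>Determinants near the identity and the measure distortion of one Euler step\<close>

definition det_slope :: "real^'n^'n \<Rightarrow> real \<Rightarrow> real" where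
  "det_slope A h = (\<Sum>p\<in>{p. p permutes UNIV}. of_int (sign p) *
     (\<Sum>i\<in>UNIV. A $ i $ p i * (\<Prod>j\<in>UNIV - {i}. (mat 1 + h *\<^sub>R A) $ j $ p j)))"

lemma det_line_has_derivative:
  fixes A :: "real^'n^'n"
  shows "((\<lambda>h. det (mat 1 + h *\<^sub>R A)) has_real_derivative det_slope A h) (at h)"
proof -
  have e: "((\<lambda>h. (mat 1 + h *\<^sub>R A) $ i $ j) has_derivative (\<lambda>y. A $ i $ j * y)) (at h)" for i j
    by (auto intro!: derivative_eq_intros)
  have "((\<lambda>h. \<Prod>i\<in>UNIV. (mat 1 + h *\<^sub>R A) $ i $ p i) has_real_derivative
      (\<Sum>i\<in>UNIV. A $ i $ p i * (\<Prod>j\<in>UNIV - {i}. (mat 1 + h *\<^sub>R A) $ j $ p j))) (at h)" for p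
    unfolding has_field_derivative_def
    by (rule has_derivative_eq_rhs[OF has_derivative_prod[OF e]])
      (simp add: fun_eq_iff sum_distrib_left mult_ac)
  then show ?thesis
    unfolding det_def det_slope_def by (intro DERIV_sum DERIV_cmult)
qed

text \<open>A permutation other than the identity moves at least two points, so after one factor is
  removed from its Leibniz product an off-diagonal entry of the identity matrix, hence 0,
  remains.\<close>

lemma det_slope_0:
  fixes A :: "real^'n^'n"
  shows "det_slope A 0 = trace A"
proof -
  have eq: "of_int (sign p) * (\<Sum>i\<in>UNIV. A $ i $ p i * (\<Prod>j\<in>UNIV - {i}. (mat 1 :: real^'n^'n) $ j $ p j))
      = (if p = id then trace A else 0)" if p: "p permutes UNIV" for p
  proof (cases "p = id")
    case True
    then show ?thesis by (simp add: trace_def mat_def)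
  next
    case False
    have "(\<Prod>j\<in>UNIV - {i}. (mat 1 :: real^'n^'n) $ j $ p j) = 0" for i
    proof -
      obtain k where k: "p k \<noteq> k" using False by (auto simp: fun_eq_iff)
      have "p (p k) \<noteq> p k" using k permutes_inj[OF p] by (metis injD)
      then obtain j where "j \<noteq> i" "p j \<noteq> j" using k by metis
      then show ?thesis by (intro prod_zero) (auto simp: mat_def intro!: bexI[of _ j])
    qed
    then have "(\<Sum>i\<in>UNIV. A $ i $ p i * (\<Prod>j\<in>UNIV - {i}. (mat 1 :: real^'n^'n) $ j $ p j)) = 0"
      by (intro sum.neutral) (metis mult_zero_right)
    then show ?thesis using False by simp
  qed
  have "det_slope A 0 = (\<Sum>p\<in>{p :: 'n \<Rightarrow> 'n. p permutes UNIV}. if p = id then trace A else 0)"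
    unfolding det_slope_def by (intro sum.cong refl) (use eq in simp)
  also have "\<dots> = trace A" by (simp add: finite_permutations permutes_id)
  finally show ?thesis .
qed

lemma emeasure_density_compact:
  fixes \<rho> :: "'a::euclidean_space \<Rightarrow> real"
  assumes K: "compact K" and \<rho>: "continuous_on UNIV \<rho>" "\<And>x. 0 \<le> \<rho> x"
  shows "\<rho> absolutely_integrable_on K"
    and "emeasure (density lborel (\<lambda>x. ennreal (\<rho> x))) K = ennreal (integral K \<rho>)"
proof -
  show ai: "\<rho> absolutely_integrable_on K"
    using borel_integrable_compact[OF K continuous_on_subset[OF \<rho>(1)]]
    unfolding set_integrable_def by (auto intro!: integrable_completion[THEN iffD2] dest: borel_measurable_integrable)
  have "emeasure (density lborel (\<lambda>x. ennreal (\<rho> x))) K = (\<integral>\<^sup>+x. ennreal (\<rho> x) * indicator K x \<partial>lborel)"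
    using borel_measurable_continuous_onI[OF \<rho>(1)] K
    by (intro emeasure_density) (auto intro!: borel_closed compact_imp_closed)
  also have "\<dots> = ennreal (integral K \<rho>)"
    using ai \<rho>(2) by (intro nn_integral_has_integral_lebesgue')
       (auto dest: set_lebesgue_integral_eq_integral)
  finally show "emeasure (density lborel (\<lambda>x. ennreal (\<rho> x))) K = ennreal (integral K \<rho>)" .
qed

lemma emeasure_density_image_compact:
  fixes g :: "real^'n::{finite,wellorder} \<Rightarrow> real^'n::_" and \<rho> :: "real^'n::_ \<Rightarrow> real"
  assumes K: "compact K" and \<rho>: "continuous_on UNIV \<rho>" "\<And>x. 0 \<le> \<rho> x"
    and g: "\<And>x. (g has_derivative (\<lambda>v. D x *v v)) (at x)" and inj: "inj_on g K"
    and low: "\<And>x. x \<in> K \<Longrightarrow> c * \<rho> x \<le> \<bar>det (D x)\<bar> * \<rho> (g x)" and c: "0 \<le> c"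
  shows "ennreal c * emeasure (density lborel (\<lambda>x. ennreal (\<rho> x))) K
    \<le> emeasure (density lborel (\<lambda>x. ennreal (\<rho> x))) (g ` K)"
proof -
  have "continuous_on K g" using g by (meson has_derivative_continuous continuous_at_imp_continuous_on)
  then have gK: "compact (g ` K)" using K by (rule compact_continuous_image)
  note eK = emeasure_density_compact[OF K \<rho>] and eg = emeasure_density_compact[OF gK \<rho>]
  \<comment> \<open>The change of variables theorem is stated for integrands with values in
    \<open>real^'n\<close>, hence the passage through \<open>real^1\<close> and back.\<close>
  have "(\<lambda>x. vec (\<rho> x) :: real^1) absolutely_integrable_on (g ` K)"
    using eg(1) by (simp add: absolutely_integrable_on_1_iff)
  then have *: "(\<lambda>x. \<bar>det (matrix (\<lambda>v. D x *v v))\<bar> *\<^sub>R (vec (\<rho> (g x)) :: real^1)) absolutely_integrable_on K"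
    "integral K (\<lambda>x. \<bar>det (matrix (\<lambda>v. D x *v v))\<bar> *\<^sub>R (vec (\<rho> (g x)) :: real^1)) = integral (g ` K) (\<lambda>x. vec (\<rho> x))"
    using has_absolute_integral_change_of_variables_compact[OF K has_derivative_at_withinI[OF g] inj,
       of "\<lambda>x. vec (\<rho> x) :: real^1" "integral (g ` K) (\<lambda>x. vec (\<rho> x))"] by auto
  then have ai: "(\<lambda>x. \<bar>det (D x)\<bar> * \<rho> (g x)) absolutely_integrable_on K"
    and eq: "integral K (\<lambda>x. \<bar>det (D x)\<bar> * \<rho> (g x)) = integral (g ` K) \<rho>"
    by (auto simp: absolutely_integrable_on_1_iff integral_on_1_eq)
  have "c * integral K \<rho> = integral K (\<lambda>x. c * \<rho> x)" by simp
  also have "\<dots> \<le> integral K (\<lambda>x. \<bar>det (D x)\<bar> * \<rho> (g x))"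
    using eK(1) ai low
    by (intro integral_le) (auto dest: set_lebesgue_integral_eq_integral(1) intro!: integrable_on_mult_right)
  finally show ?thesis
    unfolding eK(2) eg(2) eq using c by (simp add: ennreal_leI flip: ennreal_mult')
qed

text \<open>By \<open>div\<close>, the \<open>h\<close>-derivative of the pulled-back density
  vanishes at \<open>h = 0\<close>. It is uniformly continuous on a compact set, so it stays above
  \<open>- \<epsilon> r\<close> for small \<open>h\<close>, where \<open>r\<close> is a positive
  lower bound of \<open>\<rho>\<close> on the ball. The mean value theorem then gives a density of
  at least \<open>(1 - \<epsilon> h) \<rho>\<close>.\<close>

lemma nearly_expanding_euler_step:
  fixes V :: "real^'n::{finite,wellorder} \<Rightarrow> real^'n::_" and \<rho> :: "real^'n::_ \<Rightarrow> real"
  assumes V: "lipschitz_on_balls V" "\<And>z. (V has_derivative (\<lambda>v. D z *v v)) (at z)" "continuous_on UNIV D"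
    and \<rho>: "\<And>z. \<rho> z > 0" "\<And>z. (\<rho> has_derivative (\<lambda>v. G z \<bullet> v)) (at z)" "continuous_on UNIV G"
    and div: "\<And>z. G z \<bullet> V z + \<rho> z * trace (D z) = 0"
  shows "nearly_expanding V (density lborel (\<lambda>z. ennreal (\<rho> z)))"
  unfolding nearly_expanding_def
proof (intro allI impI)
  fix N \<epsilon> :: real assume \<epsilon>: "\<epsilon> > 0"
  let ?\<mu> = "density lborel (\<lambda>z. ennreal (\<rho> z))"
  have cV: "continuous_on UNIV V" and c\<rho>: "continuous_on UNIV \<rho>"
    using V(2) \<rho>(2) by (meson has_derivative_continuous continuous_at_imp_continuous_on)+
  obtain L where L0: "L \<ge> 0" and L: "\<And>a b. a \<in> cball 0 N \<Longrightarrow> b \<in> cball 0 N \<Longrightarrow> norm (V a - V b) \<le> L * norm (a - b)"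
    using V(1) unfolding lipschitz_on_balls_def by meson
  \<comment> \<open>The pulled-back density is taken with the signed determinant, which is
    differentiable in \<open>h\<close>; replacing it by its absolute value later only increases the
    product.\<close>
  define q where "q h z = \<rho> (z + h *\<^sub>R V z) * det (mat 1 + h *\<^sub>R D z)" for h z
  define q' where "q' h z = (G (z + h *\<^sub>R V z) \<bullet> V z) * det (mat 1 + h *\<^sub>R D z)
      + \<rho> (z + h *\<^sub>R V z) * det_slope (D z) h" for h z
  have q: "((\<lambda>h. q h z) has_real_derivative q' h z) (at h)" for h z
  proof -
    have "((\<lambda>h. z + h *\<^sub>R V z) has_derivative (\<lambda>y. y *\<^sub>R V z)) (at h)"
      by (auto intro!: derivative_eq_intros)
    from has_derivative_compose[OF this \<rho>(2)]
    have "((\<lambda>h. \<rho> (z + h *\<^sub>R V z)) has_real_derivative (G (z + h *\<^sub>R V z) \<bullet> V z)) (at h)"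
      by (rule has_derivative_imp_has_field_derivative) simp
    from DERIV_mult[OF this det_line_has_derivative[of "D z" h]]
    show ?thesis unfolding q_def q'_def by (simp add: algebra_simps)
  qed
  define B where "B = {0..1::real} \<times> (cball 0 N :: (real^'n::_) set)"
  \<comment> \<open>The explicit Leibniz form of \<open>det_slope\<close> makes joint continuity in
    \<open>h\<close> and the entries of \<open>D z\<close> a matter of sums and products.\<close>
  have cq': "continuous_on B (\<lambda>(h, z). q' h z)"
  proof -
    have cz: "continuous_on B (\<lambda>w. snd w + fst w *\<^sub>R V (snd w))" "continuous_on B (\<lambda>w. V (snd w))"
      "continuous_on B (\<lambda>w. D (snd w))"
      by (intro continuous_intros continuous_on_compose2[OF cV] continuous_on_compose2[OF V(3)] subset_UNIV)+
    then have cD: "continuous_on B (\<lambda>w. D (snd w) $ i $ j)" for i j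
      by (intro continuous_on_component)
    show ?thesis
      unfolding q'_def case_prod_beta det_def det_slope_def
      by (simp add: mat_def)
        (intro continuous_intros cD cz continuous_on_compose2[OF c\<rho> cz(1)] continuous_on_compose2[OF \<rho>(3) cz(1)] subset_UNIV)
  qed
  have q'0: "q' 0 z = 0" for z
    using div[of z] by (simp add: q'_def det_slope_0)
  have cB: "compact B" unfolding B_def by (intro compact_Times) auto
  obtain r where r: "r > 0" "\<And>z. z \<in> cball 0 N \<Longrightarrow> r \<le> \<rho> z"
  proof (cases "cball 0 N = ({} :: (real^'n::_) set)")
    case True then show ?thesis using that[of 1] by auto
  next
    case False
    then obtain z0 where "\<And>z. z \<in> cball 0 N \<Longrightarrow> \<rho> z0 \<le> \<rho> z"
      using continuous_attains_inf[OF compact_cball False continuous_on_subset[OF c\<rho>]] by blast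
    then show ?thesis using that[of "\<rho> z0"] \<rho>(1) by blast
  qed
  have "uniformly_continuous_on B (\<lambda>(h, z). q' h z)"
    by (rule compact_uniformly_continuous[OF cq' cB])
  then obtain d where d: "d > 0" "\<And>v w. v \<in> B \<Longrightarrow> w \<in> B \<Longrightarrow> dist w v < d \<Longrightarrow>
      dist (case w of (h, z) \<Rightarrow> q' h z) (case v of (h, z) \<Rightarrow> q' h z) < \<epsilon> * r"
    unfolding uniformly_continuous_on_def using \<epsilon> r(1) by (metis mult_pos_pos)
  \<comment> \<open>The four bounds serve in turn: staying in \<open>B\<close>, uniform continuity,
    \<open>h L < 1\<close> for injectivity of the Euler step, and nonnegativity of
    \<open>1 - \<epsilon> h\<close>.\<close>
  define \<delta> where "\<delta> = min (min 1 d) (min (1 / (L + 1)) (1 / \<epsilon>))"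
  have \<delta>: "\<delta> > 0" using d(1) L0 \<epsilon> by (simp add: \<delta>_def)
  have low: "(1 - \<epsilon> * h) * \<rho> z \<le> q h z" if h: "0 < h" "h < \<delta>" and z: "z \<in> cball 0 N" for h z
  proof -
    obtain s where s: "s > 0" "s < h" "q h z - q 0 z = (h - 0) * q' s z"
      using MVT2[OF h(1), of "\<lambda>h. q h z" "\<lambda>h. q' h z"] q by blast
    have "dist (q' s z) (q' 0 z) < \<epsilon> * r"
      using d(2)[of "(0, z)" "(s, z)"] s h z by (auto simp: B_def \<delta>_def dist_Pair_Pair)
    then have "- (\<epsilon> * r) \<le> q' s z" by (auto simp: q'0 dist_real_def)
    then have "h * - (\<epsilon> * r) \<le> h * q' s z" using h(1) by (intro mult_left_mono) auto
    moreover have "h * (\<epsilon> * r) \<le> h * (\<epsilon> * \<rho> z)" using h(1) \<epsilon> r(2)[OF z] by (intro mult_left_mono) auto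
    moreover have "q 0 z = \<rho> z" by (simp add: q_def)
    ultimately show ?thesis using s(3) by (simp add: algebra_simps)
  qed
  have "ennreal (1 - \<epsilon> * h) * emeasure ?\<mu> K \<le> emeasure ?\<mu> (euler_step V h ` K)"
    if h: "0 < h" "h < \<delta>" and K: "compact K" "K \<subseteq> cball 0 N" for h K
  proof (rule emeasure_density_image_compact[OF K(1) c\<rho>, where D="\<lambda>z. mat 1 + h *\<^sub>R D z"])
    show "0 \<le> \<rho> x" for x using \<rho>(1) less_imp_le by blast
    show "(euler_step V h has_derivative (*v) (mat 1 + h *\<^sub>R D x)) (at x)" for x
      unfolding euler_step_def
      by (auto intro!: derivative_eq_intros V(2) simp: fun_eq_iff matrix_vector_mult_add_rdistrib scaleR_matrix_vector_assoc)
    show "inj_on (euler_step V h) K"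
    proof (rule inj_onI)
      fix a b assume ab: "a \<in> K" "b \<in> K" "euler_step V h a = euler_step V h b"
      have "a - b = h *\<^sub>R (V b - V a)" using ab(3) by (simp add: euler_step_def algebra_simps)
      then have "norm (a - b) = h * norm (V b - V a)" using h(1) by simp
      also have "\<dots> \<le> h * (L * norm (b - a))" using L[OF subsetD[OF K(2) ab(2)] subsetD[OF K(2) ab(1)]] h(1) by (intro mult_left_mono) auto
      finally have "norm (a - b) \<le> (h * L) * norm (a - b)" by (simp add: norm_minus_commute)
      moreover have "h * L < 1"
      proof -
        have "h < 1 / (L + 1)" using h(2) by (simp add: \<delta>_def)
        then have "h * (L + 1) < 1" using L0 by (simp add: field_simps)
        then show ?thesis using h(1) by (simp add: algebra_simps)
      qed
      ultimately have "norm (a - b) = 0"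
        by (metis mult_less_cancel_right2 norm_ge_zero not_less order_le_less)
      then show "a = b" by simp
    qed
    show "(1 - \<epsilon> * h) * \<rho> x \<le> \<bar>det (mat 1 + h *\<^sub>R D x)\<bar> * \<rho> (euler_step V h x)" if "x \<in> K" for x
    proof -
      have "(1 - \<epsilon> * h) * \<rho> x \<le> q h x" using low h K that by blast
      also have "\<dots> \<le> \<bar>det (mat 1 + h *\<^sub>R D x)\<bar> * \<rho> (euler_step V h x)"
        unfolding q_def euler_step_def using \<rho>(1)[of "x + h *\<^sub>R V x"]
        by (subst mult.commute) (intro mult_right_mono, auto)
      finally show ?thesis .
    qed
    show "0 \<le> 1 - \<epsilon> * h"
    proof -
      have "h < 1 / \<epsilon>" using h(2) by (simp add: \<delta>_def)
      then show ?thesis using \<epsilon> by (simp add: field_simps)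
    qed
  qed
  then show "\<exists>\<delta>>0. \<forall>h K. 0 < h \<and> h < \<delta> \<and> compact K \<and> K \<subseteq> cball 0 N \<longrightarrow>
     ennreal (1 - \<epsilon> * h) * emeasure ?\<mu> K \<le> emeasure ?\<mu> (euler_step V h ` K)"
    using \<delta> by blast
qed

text \<open>The operator norm of the derivative is at most the sum of the norms of its values on the
  basis, a continuous function of the point and so bounded on balls.\<close>

lemma lipschitz_on_balls_C1:
  fixes V :: "'a::euclidean_space \<Rightarrow> 'a"
  assumes V: "\<And>z. (V has_derivative V' z) (at z)" and cont: "\<And>v. continuous_on UNIV (\<lambda>z. V' z v)"
  shows "lipschitz_on_balls V"
  unfolding lipschitz_on_balls_def
proof
  fix N :: real
  define B where "B z = (\<Sum>b\<in>Basis. norm (V' z b))" for z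
  have "continuous_on (cball 0 N) B"
    unfolding B_def by (intro continuous_intros continuous_on_subset[OF cont]) auto
  then have "bounded (B ` cball 0 N)"
    by (intro compact_imp_bounded compact_continuous_image) auto
  then obtain L where L: "L > 0" "\<And>z. z \<in> cball 0 N \<Longrightarrow> norm (B z) \<le> L" by (auto simp: bounded_pos)
  have on: "onorm (V' z) \<le> L" if "z \<in> cball 0 N" for z
  proof (rule onorm_le)
    fix v
    have lin: "linear (V' z)" using V has_derivative_linear by blast
    have "V' z v = (\<Sum>b\<in>Basis. (v \<bullet> b) *\<^sub>R V' z b)"
      using lin by (subst euclidean_representation[of v, symmetric]) (simp only: linear_sum linear_scale)
    also have "norm \<dots> \<le> (\<Sum>b\<in>Basis. norm v * norm (V' z b))"
      by (intro sum_norm_le) (auto intro!: mult_right_mono Basis_le_norm)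
    also have "\<dots> = B z * norm v" by (simp add: B_def sum_distrib_left mult.commute)
    also have "\<dots> \<le> L * norm v" using L(2)[OF that] by (intro mult_right_mono) auto
    finally show "norm (V' z v) \<le> L * norm v" .
  qed
  show "\<exists>L\<ge>0. \<forall>x\<in>cball 0 N. \<forall>y\<in>cball 0 N. norm (V x - V y) \<le> L * norm (x - y)"
    using L(1) by (intro exI[of _ L] conjI ballI differentiable_bound[of "cball 0 N" V V'] on)
      (auto intro: has_derivative_at_withinI V)
qed

text \<open>The change of variables theorem is stated for well-ordered index types only, whereas the index type
of the shape space is an arbitrary finite type; hence the detour through an enumeration of the basis.\<close>

locale basis_chart =
  fixes \<beta> :: "'n::{finite,wellorder} \<Rightarrow> 'a::euclidean_space"
  assumes bij: "bij_betw \<beta> UNIV Basis"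
begin

definition from_vec :: "(real, 'n) vec \<Rightarrow> 'a" where "from_vec x = (\<Sum>k\<in>UNIV. x $ k *\<^sub>R \<beta> k)"
definition to_vec :: "'a \<Rightarrow> (real, 'n) vec" where "to_vec y = (\<chi> k. y \<bullet> \<beta> k)"

lemma sum_Basis: "(\<Sum>b\<in>Basis. f b) = (\<Sum>k\<in>UNIV. f (\<beta> k))"
  using sum.reindex_bij_betw[OF bij, of f] by simp

lemma \<beta>_in: "\<beta> k \<in> Basis" using bij by (auto simp: bij_betw_def)

lemma \<beta>_inner: "\<beta> j \<bullet> \<beta> k = (if j = k then 1 else 0)"
  using bij inner_Basis[OF \<beta>_in \<beta>_in, of j k] by (auto simp: bij_betw_def inj_on_def)

lemma from_to [simp]: "from_vec (to_vec y) = y"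
  unfolding from_vec_def to_vec_def using euclidean_representation[of y] by (simp add: sum_Basis)

lemma from_vec_inner: "from_vec x \<bullet> \<beta> k = x $ k"
  unfolding from_vec_def
  by (simp add: inner_sum_left \<beta>_inner if_distrib[of "\<lambda>u. _ * u"] cong: if_cong)

lemma to_from [simp]: "to_vec (from_vec x) = x"
  by (simp add: to_vec_def vec_eq_iff from_vec_inner)

lemma inner_to_vec: "to_vec a \<bullet> to_vec b = a \<bullet> b"
  unfolding euclidean_inner[of a b] sum_Basis by (simp add: to_vec_def inner_vec_def)

lemma norm_to_vec [simp]: "norm (to_vec a) = norm a"
  by (simp add: norm_eq_sqrt_inner inner_to_vec)

lemma linear_to_vec: "linear to_vec"
  by (auto intro!: linearI simp: to_vec_def vec_eq_iff inner_left_distrib)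

lemma linear_from_vec: "linear from_vec"
  by (auto intro!: linearI simp: from_vec_def scaleR_add_left sum.distrib scaleR_sum_right)

lemma bounded_linear_to_vec: "bounded_linear to_vec"
  using linear_to_vec linear_conv_bounded_linear by blast

lemma bounded_linear_from_vec: "bounded_linear from_vec"
  using linear_from_vec linear_conv_bounded_linear by blast

text \<open>The chart only relabels coordinates, so boxes pull back to boxes with the same side
  lengths, and the measure of boxes determines Lebesgue measure.\<close>

lemma distr_from_vec: "distr lborel borel from_vec = lborel"
proof (rule lborel_eqI[symmetric])
  have m [measurable]: "from_vec \<in> borel_measurable borel"
    by (intro borel_measurable_continuous_onI linear_continuous_on bounded_linear_from_vec)
  fix l u :: 'a assume lu: "\<And>b. b \<in> Basis \<Longrightarrow> l \<bullet> b \<le> u \<bullet> b"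
  have "from_vec -` box l u = box (to_vec l) (to_vec u)"
  proof -
    have "from_vec x \<in> box l u \<longleftrightarrow> x \<in> box (to_vec l) (to_vec u)" for x
    proof -
      have "from_vec x \<in> box l u \<longleftrightarrow> (\<forall>k. l \<bullet> \<beta> k < x $ k \<and> x $ k < u \<bullet> \<beta> k)"
        using bij unfolding mem_box bij_betw_def by (metis (mono_tags) from_vec_inner rangeE rangeI)
      then show ?thesis by (simp add: mem_box_cart to_vec_def)
    qed
    then show ?thesis by auto
  qed
  then have "emeasure (distr lborel borel from_vec) (box l u) = emeasure lborel (box (to_vec l) (to_vec u))"
    by (simp add: emeasure_distr)
  also have "\<dots> = ennreal (\<Prod>b\<in>Basis. (to_vec u - to_vec l) \<bullet> b)"
    using lu \<beta>_in by (intro emeasure_lborel_box) (auto simp: Basis_vec_def inner_axis to_vec_def)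
  also have "(\<Prod>b\<in>Basis. (to_vec u - to_vec l) \<bullet> b) = (\<Prod>k\<in>UNIV. (u - l) \<bullet> \<beta> k)"
  proof -
    have Basis: "(Basis :: ((real, 'n) vec) set) = range (\<lambda>k. axis k 1)" by (auto simp: Basis_vec_def)
    have "inj (\<lambda>k::'n. axis k (1::real))" by (auto simp: inj_on_def axis_eq_axis)
    then show ?thesis
      unfolding Basis by (simp add: prod.reindex inner_axis to_vec_def inner_diff_left)
  qed
  also have "\<dots> = (\<Prod>b\<in>Basis. (u - l) \<bullet> b)"
    using prod.reindex_bij_betw[OF bij, of "\<lambda>b. (u - l) \<bullet> b"] by simp
  finally show "emeasure (distr lborel borel from_vec) (box l u) = (\<Prod>b\<in>Basis. (u - l) \<bullet> b)" .
qed simp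

lemma emeasure_density_to_vec:
  assumes \<rho>: "\<rho> \<in> borel_measurable borel" and K: "K \<in> sets borel"
  shows "emeasure (density lborel (\<lambda>z. ennreal (\<rho> z))) K
    = emeasure (density lborel (\<lambda>x. ennreal (\<rho> (from_vec x)))) (to_vec ` K)"
proof -
  have m [measurable]: "from_vec \<in> borel_measurable borel"
    by (intro borel_measurable_continuous_onI linear_continuous_on bounded_linear_from_vec)
  note [measurable] = \<rho> K
  have im: "to_vec ` K = from_vec -` K" by (force intro: image_eqI[where x="from_vec x" for x])
  have "emeasure (density lborel (\<lambda>z. ennreal (\<rho> z))) K = (\<integral>\<^sup>+z. ennreal (\<rho> z) * indicator K z \<partial>lborel)"
    by (intro emeasure_density) auto
  also have "\<dots> = (\<integral>\<^sup>+z. ennreal (\<rho> z) * indicator K z \<partial>(distr lborel borel from_vec))"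
    by (simp add: distr_from_vec)
  also have "\<dots> = (\<integral>\<^sup>+x. ennreal (\<rho> (from_vec x)) * indicator K (from_vec x) \<partial>lborel)"
    by (intro nn_integral_distr) auto
  also have "\<dots> = (\<integral>\<^sup>+x. ennreal (\<rho> (from_vec x)) * indicator (from_vec -` K) x \<partial>lborel)"
    by (simp add: indicator_vimage)
  also have "\<dots> = emeasure (density lborel (\<lambda>x. ennreal (\<rho> (from_vec x)))) (from_vec -` K)"
    using measurable_sets_borel[OF m K] by (intro emeasure_density[symmetric]) auto
  finally show ?thesis unfolding im .
qed

text \<open>Everything is transported by the linear isometry \<open>to_vec\<close>: it preserves
  balls, divergence and density integrals, and by linearity it carries Euler steps of
  \<open>V\<close> to Euler steps of the transported field.\<close>

lemma nearly_expanding_if_divergence_free: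
  fixes V :: "'a \<Rightarrow> 'a" and \<rho> :: "'a \<Rightarrow> real"
  assumes V: "\<And>z. (V has_derivative V' z) (at z)" "\<And>v. continuous_on UNIV (\<lambda>z. V' z v)"
    and \<rho>: "\<And>z. \<rho> z > 0" "\<And>z. (\<rho> has_derivative (\<lambda>v. G z \<bullet> v)) (at z)" "continuous_on UNIV G"
    and div: "\<And>z. G z \<bullet> V z + \<rho> z * (\<Sum>b\<in>Basis. V' z b \<bullet> b) = 0"
  shows "nearly_expanding V (density lborel (\<lambda>z. ennreal (\<rho> z)))"
proof -
  define W where "W x = to_vec (V (from_vec x))" for x
  define D :: "(real, 'n) vec \<Rightarrow> ((real, 'n) vec, 'n) vec" where "D x = (\<chi> i j. V' (from_vec x) (\<beta> j) \<bullet> \<beta> i)" for x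
  define r where "r x = \<rho> (from_vec x)" for x
  define H where "H x = to_vec (G (from_vec x))" for x
  have cf: "continuous_on UNIV from_vec" "continuous_on UNIV to_vec"
    by (auto intro!: linear_continuous_on bounded_linear_from_vec bounded_linear_to_vec)
  have df: "(from_vec has_derivative from_vec) F" "(to_vec has_derivative to_vec) F'" for F F'
    by (auto intro!: bounded_linear_imp_has_derivative bounded_linear_from_vec bounded_linear_to_vec)
  have W: "(W has_derivative (\<lambda>v. D x *v v)) (at x)" for x
  proof -
    have "linear (V' (from_vec x))" using V(1) has_derivative_linear by blast
    then have "V' (from_vec x) (from_vec v) = (\<Sum>k\<in>UNIV. v $ k *\<^sub>R V' (from_vec x) (\<beta> k))" for v
      unfolding from_vec_def[of v] by (simp only: linear_sum linear_scale)
    then have eq: "to_vec (V' (from_vec x) (from_vec v)) = D x *v v" for v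
      by (simp add: to_vec_def D_def matrix_vector_mult_def vec_eq_iff inner_sum_left mult.commute)
    have "((\<lambda>x. to_vec (V (from_vec x))) has_derivative (\<lambda>v. to_vec (V' (from_vec x) (from_vec v)))) (at x)"
      by (rule has_derivative_compose[OF has_derivative_compose[OF df(1) V(1)] df(2)])
    then show ?thesis unfolding W_def eq .
  qed
  have cD: "continuous_on UNIV D"
    unfolding D_def by (intro continuous_intros continuous_on_compose2[OF V(2) cf(1)]) auto
  have r: "(r has_derivative (\<lambda>v. H x \<bullet> v)) (at x)" for x
  proof -
    have eq: "G (from_vec x) \<bullet> from_vec v = H x \<bullet> v" for v
      using inner_to_vec[of "G (from_vec x)" "from_vec v"] by (simp add: H_def)
    show ?thesis
      using has_derivative_compose[OF df(1) \<rho>(2), of x UNIV] unfolding r_def eq .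
  qed
  have cH: "continuous_on UNIV H"
    unfolding H_def by (rule continuous_on_compose2[OF cf(2) continuous_on_compose2[OF \<rho>(3) cf(1)]]) auto
  have lW: "lipschitz_on_balls W"
    by (rule lipschitz_on_balls_C1[OF W]) (simp add: matrix_vector_mult_def, intro continuous_intros continuous_on_component cD)
  have divW: "H x \<bullet> W x + r x * trace (D x) = 0" for x
    using div[of "from_vec x"]
    by (simp add: H_def W_def inner_to_vec r_def sum_Basis trace_def D_def)
  have ne: "nearly_expanding W (density lborel (\<lambda>x. ennreal (r x)))"
    by (rule nearly_expanding_euler_step[OF lW W cD _ r cH divW]) (simp add: r_def \<rho>(1))
  have c\<rho>: "continuous_on UNIV \<rho>"
    using \<rho>(2) by (meson has_derivative_continuous continuous_at_imp_continuous_on)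
  have m\<rho>: "\<rho> \<in> borel_measurable borel" by (rule borel_measurable_continuous_onI[OF c\<rho>])
  have cV: "continuous_on UNIV V"
    using V(1) by (meson has_derivative_continuous continuous_at_imp_continuous_on)
  show ?thesis
    unfolding nearly_expanding_def
  proof (intro allI impI)
    fix N \<epsilon> :: real assume "\<epsilon> > 0"
    then obtain \<delta> where \<delta>: "\<delta> > 0" "\<forall>h K. 0 < h \<and> h < \<delta> \<and> compact K \<and> K \<subseteq> cball 0 N \<longrightarrow>
       ennreal (1 - \<epsilon> * h) * emeasure (density lborel (\<lambda>x. ennreal (r x))) K
       \<le> emeasure (density lborel (\<lambda>x. ennreal (r x))) (euler_step W h ` K)"
      using ne unfolding nearly_expanding_def by blast
    show "\<exists>\<delta>>0. \<forall>h K. 0 < h \<and> h < \<delta> \<and> compact K \<and> K \<subseteq> cball 0 N \<longrightarrow>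
       ennreal (1 - \<epsilon> * h) * emeasure (density lborel (\<lambda>z. ennreal (\<rho> z))) K
       \<le> emeasure (density lborel (\<lambda>z. ennreal (\<rho> z))) (euler_step V h ` K)"
    proof (intro exI[of _ \<delta>] conjI allI impI)
      fix h :: real and K :: "'a set" assume a: "0 < h \<and> h < \<delta> \<and> compact K \<and> K \<subseteq> cball 0 N"
      have "compact (to_vec ` K)"
        using a by (intro compact_continuous_image continuous_on_subset[OF cf(2)]) auto
      moreover have "to_vec ` K \<subseteq> cball 0 N" using a by auto
      ultimately have le: "ennreal (1 - \<epsilon> * h) * emeasure (density lborel (\<lambda>x. ennreal (r x))) (to_vec ` K)
       \<le> emeasure (density lborel (\<lambda>x. ennreal (r x))) (euler_step W h ` to_vec ` K)"
        using \<delta>(2) a by blast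
      have eu: "to_vec ` euler_step V h ` K = euler_step W h ` to_vec ` K"
        by (auto simp: euler_step_def W_def image_image linear_add[OF linear_to_vec] linear_scale[OF linear_to_vec])
      have cE: "compact (euler_step V h ` K)"
        unfolding euler_step_def using a
        by (intro compact_continuous_image continuous_intros continuous_on_subset[OF cV]) auto
      show "ennreal (1 - \<epsilon> * h) * emeasure (density lborel (\<lambda>z. ennreal (\<rho> z))) K
       \<le> emeasure (density lborel (\<lambda>z. ennreal (\<rho> z))) (euler_step V h ` K)"
        using le a cE
        by (simp add: emeasure_density_to_vec[OF m\<rho>] borel_compact eu r_def)
    qed (rule \<delta>(1))
  qed
qed

theorem liouville_invariant_measure:
  fixes V :: "'a \<Rightarrow> 'a" and \<rho> :: "'a \<Rightarrow> real"
  assumes V: "\<And>z. (V has_derivative V' z) (at z)" "\<And>v. continuous_on UNIV (\<lambda>z. V' z v)"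
    and \<rho>: "\<And>z. \<rho> z > 0" "\<And>z. (\<rho> has_derivative (\<lambda>v. G z \<bullet> v)) (at z)" "continuous_on UNIV G"
    and div: "\<And>z. G z \<bullet> V z + \<rho> z * (\<Sum>b\<in>Basis. V' z b \<bullet> b) = 0"
  shows "invariant_measure V \<rho>"
proof (rule invariant_measureI)
  show "lipschitz_on_balls V" by (rule lipschitz_on_balls_C1[OF V])
  have c\<rho>: "continuous_on UNIV \<rho>"
    using \<rho>(2) by (meson has_derivative_continuous continuous_at_imp_continuous_on)
  show "emeasure (density lborel (\<lambda>z. ennreal (\<rho> z))) (cball 0 N) < \<infinity>" for N
    by (subst emeasure_density_compact(2)[OF compact_cball c\<rho>]) (auto intro: less_imp_le \<rho>(1))
  show "nearly_expanding V (density lborel (\<lambda>z. ennreal (\<rho> z)))"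
    by (rule nearly_expanding_if_divergence_free[OF V \<rho> div])
  show "nearly_expanding (\<lambda>z. - V z) (density lborel (\<lambda>z. ennreal (\<rho> z)))"
  proof (rule nearly_expanding_if_divergence_free[OF _ _ \<rho>])
    show "((\<lambda>z. - V z) has_derivative (\<lambda>v. - V' z v)) (at z)" for z by (intro derivative_intros V(1))
    show "continuous_on UNIV (\<lambda>z. - V' z v)" for v by (intro continuous_intros V(2))
    show "G z \<bullet> - V z + \<rho> z * (\<Sum>b\<in>Basis. - V' z b \<bullet> b) = 0" for z
      using div[of z] by (simp add: sum_negf algebra_simps)
  qed
qed

end

section \<open>Horizontal lifts, metric and brackets\<close>

lemma matrix_inv_eqI:
  fixes A B :: "real^'n^'n"
  assumes "A ** B = mat 1"
  shows "matrix_inv A = B"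
proof -
  have BA: "B ** A = mat 1" using assms matrix_left_right_inverse by blast
  then have "A ** matrix_inv A = mat 1 \<and> matrix_inv A ** A = mat 1"
    unfolding matrix_inv_def using assms by (intro someI) blast
  then have "matrix_inv A ** (A ** B) = B" by (simp add: matrix_mul_assoc)
  then show ?thesis using assms by simp
qed

lemma sum_UNIV_option:
  fixes f :: "'a::finite option \<Rightarrow> 'b::comm_monoid_add"
  shows "(\<Sum>k\<in>UNIV. f k) = f None + (\<Sum>i\<in>UNIV. f (Some i))"
  by (simp add: UNIV_option_conv sum.reindex)

text \<open>The angular velocity of the horizontal lift of the i-th coordinate field: rolling
  prescribes the last column, skew symmetry then the last row, and the rubber constraint clears the
  remaining block.\<close>

definition lift_angvel :: "real \<Rightarrow> 'm::finite \<Rightarrow> real^('m option)^('m option)" where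
  "lift_angvel R i = (\<chi> k l. if k = Some i \<and> l = None then - 1 / R
     else if k = None \<and> l = Some i then 1 / R else 0)"

lemma lift_angvel_simps [simp]:
  "lift_angvel R i $ None $ None = 0"
  "lift_angvel R i $ Some j $ None = (if i = j then - 1 / R else 0)"
  "lift_angvel R i $ None $ Some j = (if i = j then 1 / R else 0)"
  "lift_angvel R i $ Some j $ Some k = 0"
  by (auto simp: lift_angvel_def)

text \<open>Stated for all invertible matrices and not just rotations, because
  \<open>lie_bracket\<close> differentiates in the ambient matrix space.\<close>

lemma hor_eq:
  fixes q :: "('m::finite) amb"
  assumes R: "R \<noteq> 0" and g: "invertible (snd q)"
  shows "hor R q i = (axis i 1, snd q ** lift_angvel R i)"
  unfolding hor_def
proof (rule the_equality)
  have inv: "matrix_inv (snd q) ** snd q = mat 1" "snd q ** matrix_inv (snd q) = mat 1"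
    using g matrix_inv_eqI unfolding invertible_def by metis+
  have "Omega_of q (axis i 1, snd q ** lift_angvel R i) = lift_angvel R i"
    by (simp add: Omega_of_def matrix_mul_assoc inv)
  moreover have "transpose (lift_angvel R i) = - lift_angvel R i"
    by (auto simp: vec_eq_iff split_option_all transpose_def)
  moreover have "fullXd (axis i 1) = - R *\<^sub>R (lift_angvel R i *v axis None 1)"
    using R by (simp add: vec_eq_iff split_option_all fullXd_def matrix_vector_mult_basis column_def)
      (simp add: axis_def)
  ultimately show "(axis i 1, snd q ** lift_angvel R i) \<in> Dist R q \<and> fst (axis i 1, snd q ** lift_angvel R i) = axis i 1"
    by (simp add: Dist_def Let_def)
  fix v :: "'m amb" assume v: "v \<in> Dist R q \<and> fst v = axis i 1"
  define \<Omega> where "\<Omega> = Omega_of q v"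
  have skew: "transpose \<Omega> = - \<Omega>" and X: "fullXd (axis i 1) = - R *\<^sub>R (\<Omega> *v axis None 1)"
    and rub: "\<And>\<mu> \<nu>. \<Omega> $ Some \<mu> $ Some \<nu> = 0"
    using v by (auto simp: Dist_def Let_def \<Omega>_def)
  have sk: "\<Omega> $ k $ l = - \<Omega> $ l $ k" for k l
  proof -
    have "transpose \<Omega> $ l $ k = (- \<Omega>) $ l $ k" by (simp only: skew)
    then show ?thesis by (simp only: transpose_def vec_lambda_beta vector_uminus_component)
  qed
  have NN: "\<Omega> $ None $ None = 0" using sk[of None None] by linarith
  have SN: "\<Omega> $ Some j $ None = (if i = j then - 1 / R else 0)" for j
  proof -
    have "fullXd (axis i 1) $ Some j = (- R *\<^sub>R (\<Omega> *v axis None 1)) $ Some j" using X by simp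
    then have "axis i 1 $ j = - R * \<Omega> $ Some j $ None"
      by (simp add: fullXd_def matrix_vector_mult_basis column_def)
    then show ?thesis using R by (auto simp: axis_def field_simps split: if_splits)
  qed
  have "\<Omega> = lift_angvel R i"
    unfolding vec_eq_iff
  proof (intro allI)
    fix k l
    show "\<Omega> $ k $ l = lift_angvel R i $ k $ l"
      using SN rub NN sk[of None "Some x" for x] by (cases k; cases l) auto
  qed
  then have "snd q ** \<Omega> = snd q ** lift_angvel R i" by simp
  then have "snd v = snd q ** lift_angvel R i" 
    by (simp add: \<Omega>_def Omega_of_def matrix_mul_assoc inv)
  then show "v = (axis i 1, snd q ** lift_angvel R i)" using v by (simp add: prod_eq_iff)
qed

lemma invertible_mat_1: "invertible (mat 1 :: real^'n^'n)"
  unfolding invertible_def by (rule exI[of _ "mat 1"]) simp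

lemma hor_basept:
  assumes "R \<noteq> 0"
  shows "hor R (basept s) i = (axis i 1, lift_angvel R i)"
  using hor_eq[OF assms, of "basept s" i] by (simp add: basept_def invertible_mat_1)

lemma bounded_linear_matrix_mult_right:
  fixes B :: "real^'n^'n"
  shows "bounded_linear (\<lambda>A :: real^'n^'n. A ** B)"
  by (auto intro!: linear_conv_bounded_linear[THEN iffD1] linearI
      simp: matrix_matrix_mult_def vec_eq_iff algebra_simps sum.distrib sum_distrib_left)

text \<open>Near the identity all matrices are invertible, so \<open>hor\<close> coincides there
  with its closed form, which is linear in \<open>g\<close>.\<close>

lemma hor_has_derivative:
  fixes s :: "real^'m::finite"
  assumes R: "R \<noteq> 0"
  shows "((\<lambda>q. hor R q i) has_derivative (\<lambda>w. (0, snd w ** lift_angvel R i))) (at (basept s))"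
proof -
  let ?U = "{q :: 'm amb. det (snd q) \<noteq> 0}"
  have op: "open ?U"
    by (intro open_Collect_neq continuous_intros) (auto simp: det_def intro!: continuous_intros)
  have mem: "basept s \<in> ?U" by (simp add: basept_def)
  have der: "((\<lambda>q :: 'm amb. (axis i 1 :: real^'m, snd q ** lift_angvel R i)) has_derivative
      (\<lambda>w. (0, snd w ** lift_angvel R i))) (at (basept s))"
    by (intro derivative_intros bounded_linear.has_derivative[OF bounded_linear_matrix_mult_right])
  show ?thesis
    by (rule has_derivative_transform_within_open[OF der op mem]) (simp add: hor_eq[OF R] invertible_det_nz)
qed

text \<open>The lifts are the left-invariant fields \<open>g A_i\<close> with constant first
  component, so at the identity their bracket is the matrix commutator.\<close>

lemma lie_bracket_hor:
  assumes R: "R \<noteq> 0"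
  shows "lie_bracket (\<lambda>q. hor R q i) (\<lambda>q. hor R q j) (basept s)
    = (0, lift_angvel R i ** lift_angvel R j - lift_angvel R j ** lift_angvel R i)"
  unfolding lie_bracket_def frechet_derivative_at[OF hor_has_derivative[OF R], symmetric]
  by (simp add: hor_basept[OF R])

lemma kappa_diagonal:
  fixes J A B :: "real^'n^'n"
  assumes "\<forall>i j. i \<noteq> j \<longrightarrow> J $ i $ j = 0"
  shows "kappa (J ** A + A ** J) B = - (1/2) * (\<Sum>k\<in>UNIV. \<Sum>l\<in>UNIV. (J $ k $ k + J $ l $ l) * A $ k $ l * B $ l $ k)"
proof -
  have "(J ** A) $ k $ l = J $ k $ k * A $ k $ l" for k l
  proof -
    have "(J ** A) $ k $ l = (\<Sum>r\<in>UNIV. if r = k then J $ k $ k * A $ k $ l else 0)"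
      unfolding matrix_matrix_mult_def by (simp only: vec_lambda_beta, intro sum.cong refl) (use assms in auto)
    then show ?thesis by simp
  qed
  moreover have "(A ** J) $ k $ l = J $ l $ l * A $ k $ l" for k l
  proof -
    have "(A ** J) $ k $ l = (\<Sum>r\<in>UNIV. if r = l then J $ l $ l * A $ k $ l else 0)"
      unfolding matrix_matrix_mult_def by (simp only: vec_lambda_beta, intro sum.cong refl) (use assms in auto)
    then show ?thesis by simp
  qed
  ultimately show ?thesis
    unfolding kappa_def trace_def matrix_matrix_mult_def[of "J ** A + A ** J" B]
    by (simp add: algebra_simps)
qed

text \<open>Both summands of \<open>Lag\<close> are quadratic forms of symmetric bilinear forms, so
  polarisation recovers these; \<open>Q\<close> is symmetric by exchange of its two summation
  indices.\<close>

lemma metric_basept: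
  fixes J :: "real^('m::finite option)^('m option)"
  assumes J: "\<forall>i j. i \<noteq> j \<longrightarrow> J $ i $ j = 0"
  shows "metric R a mass J (basept s) v w =
    - (1/2) * (\<Sum>k\<in>UNIV. \<Sum>l\<in>UNIV. (J $ k $ k + J $ l $ l) * snd v $ k $ l * snd w $ l $ k)
    + mass * ((fullXd (fst v) + snd v *v fullX R a s) \<bullet> (fullXd (fst w) + snd w *v fullX R a s))"
proof -
  have inv1: "matrix_inv (mat 1) = (mat 1 :: real^('m option)^('m option))" by (rule matrix_inv_eqI) simp
  define X where "X = fullX R a s"
  define Q where "Q A B = (\<Sum>k\<in>UNIV. \<Sum>l\<in>UNIV. (J $ k $ k + J $ l $ l) * A $ k $ l * B $ l $ k)"
    for A B :: "real^('m option)^('m option)"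
  define y where "y u = fullXd (fst u) + snd u *v X" for u :: "'m amb"
  have Lag: "Lag R a mass J (basept s) u = - (1/4) * Q (snd u) (snd u) + mass / 2 * (y u \<bullet> y u)" for u
    unfolding Lag_def Let_def Omega_of_def basept_def
    by (simp add: inv1 kappa_diagonal[OF J] Q_def y_def X_def power2_norm_eq_inner)
  have Qadd: "Q (A + A') B = Q A B + Q A' B" "Q B (A + A') = Q B A + Q B A'" for A A' B
    by (simp_all add: Q_def algebra_simps sum.distrib)
  have Qsym: "Q B A = Q A B" for A B
    unfolding Q_def by (subst sum.swap) (simp add: algebra_simps)
  have yadd: "y (v + w) = y v + y w"
    by (simp add: y_def fullXd_def matrix_vector_mult_add_rdistrib vec_eq_iff split: option.split)
  have "metric R a mass J (basept s) v w = - (1/2) * Q (snd v) (snd w) + mass * (y v \<bullet> y w)"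
    unfolding metric_def Lag yadd snd_add Qadd Qsym[of "snd v" "snd w"]
    by (simp add: algebra_simps inner_commute)
  then show ?thesis by (simp add: Q_def y_def X_def)
qed

text \<open>The last coordinate \<open>R + a\<close> of \<open>X\<close> is multiplied by
  \<open>- 1 / R\<close>; the part coming from \<open>R\<close> cancels the unit velocity and leaves
  \<open>- a / R\<close>.\<close>

lemma hor_velocity:
  assumes R: "R \<noteq> 0"
  shows "fullXd (axis i 1) + lift_angvel R i *v fullX R a s
    = (\<chi> k. case k of None \<Rightarrow> s $ i / R | Some j \<Rightarrow> if i = j then - a / R else 0)"
proof -
  have "(\<Sum>j\<in>UNIV. (if i = j then 1 / R else 0) * s $ j) = s $ i / R"
    by (simp add: if_distrib[of "\<lambda>u. u * _"] cong: if_cong)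
  then show ?thesis
    using R by (simp add: vec_eq_iff split_option_all fullXd_def fullX_def matrix_vector_mult_def sum_UNIV_option)
      (simp add: axis_def field_simps)
qed

lemma Kmat_eq:
  fixes J :: "real^('m::finite option)^('m option)"
  assumes J: "\<forall>i j. i \<noteq> j \<longrightarrow> J $ i $ j = 0" and R: "R \<noteq> 0"
  shows "Kmat R a mass J s $ i $ j = ((if i = j then J $ Some i $ Some i + J $ None $ None + mass * a\<^sup>2 else 0)
      + mass * s $ i * s $ j) / R\<^sup>2"
proof -
  have *: "(\<Sum>k\<in>UNIV. \<Sum>l\<in>UNIV. (J $ k $ k + J $ l $ l) * lift_angvel R i $ k $ l * lift_angvel R j $ l $ k)
     = (if i = j then - 2 * (J $ Some i $ Some i + J $ None $ None) / R\<^sup>2 else 0)"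
    by (simp add: sum_UNIV_option power2_eq_square if_distrib[of "\<lambda>u. u * _"] if_distrib[of "\<lambda>u. _ * u"] cong: if_cong)
      (simp add: field_simps)
  have "Kmat R a mass J s $ i $ j = - (1/2) * (if i = j then - 2 * (J $ Some i $ Some i + J $ None $ None) / R\<^sup>2 else 0)
     + mass * ((\<chi> k. case k of None \<Rightarrow> s $ i / R | Some l \<Rightarrow> if i = l then - a / R else 0)
       \<bullet> (\<chi> k. case k of None \<Rightarrow> s $ j / R | Some l \<Rightarrow> if j = l then - a / R else 0))"
    unfolding Kmat_def by (simp add: metric_basept[OF J] hor_basept[OF R] * hor_velocity[OF R])
  also have "((\<chi> k. case k of None \<Rightarrow> s $ i / R | Some l \<Rightarrow> if i = l then - a / R else 0)
       \<bullet> (\<chi> k. case k of None \<Rightarrow> s $ j / R | Some l \<Rightarrow> if j = l then - a / R else 0 :: real))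
     = (s $ i * s $ j + (if i = j then a\<^sup>2 else 0)) / R\<^sup>2"
    by (simp add: inner_vec_def sum_UNIV_option power2_eq_square if_distrib[of "\<lambda>u. u * _"] if_distrib[of "\<lambda>u. _ * u"] cong: if_cong)
      (simp add: add_divide_distrib)
  finally show ?thesis using R by (cases "i = j") (simp_all add: add_divide_distrib algebra_simps)
qed

text \<open>The commutator lives in the first n - 1 rows and columns, where the angular velocity of
  a lift vanishes, so the inertia term is 0. What remains is the mass term, the inner product of
  \<open>[A_i, A_j] X\<close> with the velocity from \<open>hor_velocity\<close>; this is the origin
  of the factor \<open>a\<close>.\<close>

lemma metric_lie_bracket_hor:
  fixes J :: "real^('m::finite option)^('m option)"
  assumes J: "\<forall>i j. i \<noteq> j \<longrightarrow> J $ i $ j = 0" and R: "R \<noteq> 0"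
  shows "metric R a mass J (basept s) (lie_bracket (\<lambda>q. hor R q i) (\<lambda>q. hor R q j) (basept s)) (hor R (basept s) l)
    = mass * a / R ^ 3 * ((if i = l then s $ j else 0) - (if j = l then s $ i else 0))"
proof -
  let ?B = "lift_angvel R i ** lift_angvel R j - lift_angvel R j ** lift_angvel R i"
  have B: "?B $ None $ None = 0" "?B $ Some p $ None = 0" "?B $ None $ Some p = 0"
    "?B $ Some p $ Some q = ((if p = j \<and> q = i then 1 else 0) - (if p = i \<and> q = j then 1 else 0)) / R\<^sup>2" for p q
    by (auto simp: matrix_matrix_mult_def sum_UNIV_option power2_eq_square
       if_distrib[of "\<lambda>u. u * _"] if_distrib[of "\<lambda>u. _ * u"] cong: if_cong)
  have Bs: "(\<Sum>k\<in>UNIV. \<Sum>l'\<in>UNIV. (J $ k $ k + J $ l' $ l') * ?B $ k $ l' * lift_angvel R l $ l' $ k) = 0"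
    by (simp add: sum_UNIV_option B del: vector_minus_component)
  define x :: "real^('m option)" where "x = (\<chi> k. case k of None \<Rightarrow> 0 | Some p \<Rightarrow>
     ((if p = j then s $ i else 0) - (if p = i then s $ j else 0)) / R\<^sup>2)"
  define y :: "real^('m option)" where
    "y = (\<chi> k. case k of None \<Rightarrow> s $ l / R | Some p \<Rightarrow> if l = p then - a / R else 0)"
  have Bx: "?B *v fullX R a s = x"
    unfolding vec_eq_iff split_option_all matrix_vector_mult_def x_def
    by (auto simp: sum_UNIV_option B fullX_def if_distrib[of "\<lambda>u. u * _"] if_distrib[of "\<lambda>u. u / _"]
          left_diff_distrib diff_divide_distrib sum_subtractf simp del: vector_minus_component cong: if_cong)
  have X0: "fullXd (0 :: real^'m) = 0" by (simp add: fullXd_def vec_eq_iff split: option.split)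
  have "x \<bullet> y = (\<Sum>p\<in>UNIV. x $ Some p * y $ Some p)"
    by (simp add: inner_vec_def sum_UNIV_option x_def)
  also have "\<dots> = (\<Sum>p\<in>UNIV. if l = p then x $ Some p * (- a / R) else 0)"
    by (intro sum.cong refl) (simp add: y_def)
  also have "\<dots> = x $ Some l * (- a / R)" by simp
  also have "\<dots> = a / R ^ 3 * ((if i = l then s $ j else 0) - (if j = l then s $ i else 0))"
    using R by (cases "i = l"; cases "j = l") (simp_all add: x_def power2_eq_square power3_eq_cube)
  finally have xy: "x \<bullet> y = a / R ^ 3 * ((if i = l then s $ j else 0) - (if j = l then s $ i else 0))" .
  show ?thesis
    unfolding metric_basept[OF J] lie_bracket_hor[OF R] hor_basept[OF R] fst_conv snd_conv Bs hor_velocity[OF R]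
      Bx X0 y_def[symmetric] add_0_left xy by (simp only: mult_zero_right add_0_left times_divide_eq_right mult.assoc times_divide_eq_left)
qed

section \<open>The reduced equations\<close>

lemma Ck_const: "Ck k (\<lambda>x. c)"
  by (induction k arbitrary: c) (auto simp: frechet_derivative_const)

lemma Ck_component: "Ck k (\<lambda>x. c * x $ i)"
proof (cases k)
  case 0 then show ?thesis by (auto intro!: continuous_intros)
next
  case (Suc k)
  have d: "((\<lambda>x. c * x $ i) has_derivative (\<lambda>h. c * h $ i)) (at x)" for x :: "real^'a"
    by (intro has_derivative_mult_right bounded_linear_imp_has_derivative bounded_linear_vec_nth)
  show ?thesis
    unfolding Suc Ck.simps frechet_derivative_at[OF d, symmetric]
    using d by (auto intro!: continuous_intros Ck_const simp: differentiable_def)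
qed

text \<open>Each partial derivative is a multiple of a coordinate, which reduces the claim to
  \<open>Ck_component\<close>.\<close>

lemma smooth_fun_square_norm: "smooth_fun (\<lambda>x. c * (x \<bullet> x))"
  unfolding smooth_fun_def
proof
  fix k
  have d: "((\<lambda>x. c * (x \<bullet> x)) has_derivative (\<lambda>h. 2 * c * (x \<bullet> h))) (at x)" for x :: "real^'a"
    by (auto intro!: derivative_eq_intros simp: inner_commute)
  show "Ck k (\<lambda>x::real^'a. c * (x \<bullet> x))"
  proof (cases k)
    case 0 then show ?thesis by (auto intro!: continuous_intros)
  next
    case (Suc k)
    show ?thesis
      unfolding Suc Ck.simps frechet_derivative_at[OF d, symmetric]
      using d by (auto intro!: continuous_intros simp: differentiable_def inner_axis Ck_component)
  qed
qed

text \<open>The dynamics is studied as an explicit vector field with positive weights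
  \<open>d\<close> and a free constant \<open>b\<close>; body and sphere data are matched to these
  parameters only in \<open>Ham_eq\<close> and \<open>reducedVF_eq\<close>.\<close>

locale reduced_system =
  fixes R m b :: real and d :: "'m::finite \<Rightarrow> real"
  assumes R: "R > 0" and m: "m > 0" and d: "\<And>i. d i > 0"
begin

text \<open>Here \<open>K = (diag d + m s s\<^sup>T) / R\<^sup>2\<close>, and the Sherman-Morrison formula yields
\<open>K\<^sup>-\<^sup>1 = R\<^sup>2 (E - m E s (E s)\<^sup>T / G s)\<close> with \<open>E = (diag d)\<^sup>-\<^sup>1\<close>.\<close>

definition E :: "real^'m \<Rightarrow> real^'m" where "E p = (\<chi> i. p $ i / d i)"
definition G :: "real^'m \<Rightarrow> real" where "G s = 1 + m * (s \<bullet> E s)"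
definition ratio :: "real^'m \<Rightarrow> real^'m \<Rightarrow> real" where "ratio s p = (s \<bullet> E p) / G s"
definition vel :: "real^'m \<Rightarrow> real^'m \<Rightarrow> real^'m" where
  "vel s p = R\<^sup>2 *\<^sub>R (E p - (m * ratio s p) *\<^sub>R E s)"
definition energy :: "real^'m \<Rightarrow> real^'m \<Rightarrow> real" where
  "energy s p = R\<^sup>2 / 2 * (p \<bullet> E p - m * (s \<bullet> E p)\<^sup>2 / G s)"
definition grad_energy :: "real^'m \<Rightarrow> real^'m \<Rightarrow> real^'m" where
  "grad_energy s p = R\<^sup>2 *\<^sub>R ((m * ratio s p)\<^sup>2 *\<^sub>R E s - (m * ratio s p) *\<^sub>R E p)"
text \<open>The term with \<open>b\<close> is \<open>b (s_j \<delta>_ki - s_i \<delta>_kj)\<close>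
  contracted with \<open>p_k\<close> and the j-th velocity component.\<close>

definition force :: "real^'m \<Rightarrow> real^'m \<Rightarrow> real^'m" where
  "force s p = - grad_energy s p - b *\<^sub>R ((s \<bullet> vel s p) *\<^sub>R p - (p \<bullet> vel s p) *\<^sub>R s)"

lemma d_nz [simp]: "d i \<noteq> 0" using d[of i] by simp

lemma E_nth [simp]: "E p $ i = p $ i / d i" by (simp add: E_def)

lemma E_add: "E (p + q) = E p + E q" by (simp add: vec_eq_iff add_divide_distrib)
lemma E_scaleR: "E (c *\<^sub>R p) = c *\<^sub>R E p" by (simp add: vec_eq_iff)
lemma E_sym: "p \<bullet> E q = q \<bullet> E p" by (simp add: inner_vec_def mult.commute)

lemma bounded_linear_E: "bounded_linear E"
  by (auto intro!: linear_conv_bounded_linear[THEN iffD1] linearI simp: E_add E_scaleR)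

lemmas E_derivative [derivative_intros] = bounded_linear.has_derivative[OF bounded_linear_E]
lemmas E_continuous [continuous_intros] = bounded_linear.continuous_on[OF bounded_linear_E]

lemma axis_E: "axis i 1 \<bullet> E p = p $ i / d i" by (simp add: inner_axis')
lemma E_axis: "p \<bullet> E (axis i 1) = p $ i / d i" using E_sym axis_E by metis

lemma G_pos: "G s > 0"
proof -
  have "s \<bullet> E s \<ge> 0"
    unfolding inner_vec_def by (intro sum_nonneg) (auto intro!: divide_nonneg_pos d)
  then show ?thesis using m by (simp add: G_def add_pos_nonneg)
qed

lemma G_nz [simp]: "G s \<noteq> 0" using G_pos[of s] by simp

lemma s_E_s: "m * (s \<bullet> E s) = G s - 1" by (simp add: G_def)

lemma inner_vel:
  "s \<bullet> vel s p = R\<^sup>2 * ratio s p"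
proof -
  have "s \<bullet> vel s p = R\<^sup>2 * (s \<bullet> E p - ratio s p * (m * (s \<bullet> E s)))"
    by (simp add: vel_def inner_diff_right)
  also have "\<dots> = R\<^sup>2 * ratio s p"
    unfolding s_E_s ratio_def by (simp add: field_simps)
  finally show ?thesis .
qed

text \<open>Euler's identity for an energy quadratic in \<open>p\<close>; it turns the second
  gyroscopic term into a multiple of the energy.\<close>

lemma inner_vel_energy: "p \<bullet> vel s p = 2 * energy s p"
  by (simp add: vel_def energy_def ratio_def inner_diff_right E_sym[of p s] power2_eq_square algebra_simps)

lemma energy_derivative_p: "((\<lambda>t. energy s (p + t *\<^sub>R axis i 1)) has_real_derivative vel s p $ i) (at 0)"
proof -
  have eq: "(p + t *\<^sub>R axis i 1) \<bullet> E (p + t *\<^sub>R axis i 1) = p \<bullet> E p + t * (2 * (p $ i / d i)) + t * t * (1 / d i)"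
    "s \<bullet> E (p + t *\<^sub>R axis i 1) = s \<bullet> E p + t * (s $ i / d i)" for t
    by (simp_all add: E_add E_scaleR inner_add_left inner_add_right axis_E E_axis algebra_simps add_divide_distrib)
  show ?thesis
    unfolding energy_def eq
    by (auto intro!: derivative_eq_intros simp: vel_def ratio_def field_simps power2_eq_square)
qed

lemma energy_derivative_s: "((\<lambda>t. energy (s + t *\<^sub>R axis i 1) p) has_real_derivative grad_energy s p $ i) (at 0)"
proof -
  have eq: "(s + t *\<^sub>R axis i 1) \<bullet> E p = s \<bullet> E p + t * (p $ i / d i)"
    "G (s + t *\<^sub>R axis i 1) = G s + t * (2 * m * (s $ i / d i)) + t * t * (m / d i)" for t
    by (simp_all add: G_def E_add E_scaleR inner_add_left inner_add_right axis_E E_axis algebra_simps add_divide_distrib)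
  show ?thesis
    unfolding energy_def eq
    by (auto intro!: derivative_eq_intros simp: grad_energy_def ratio_def field_simps power2_eq_square)
qed

definition Kinverse :: "real^'m \<Rightarrow> real^'m^'m" where
  "Kinverse s = (\<chi> i j. R\<^sup>2 * ((if i = j then 1 / d j else 0) - m * s $ i * s $ j / (d i * d j * G s)))"

lemma matrix_inv_K:
  assumes "\<And>i j. K $ i $ j = ((if i = j then d i else 0) + m * s $ i * s $ j) / R\<^sup>2"
  shows "matrix_inv K = Kinverse s"
proof (rule matrix_inv_eqI)
  have "(K ** Kinverse s) $ i $ j = (if i = j then 1 else 0)" for i j
  proof -
    have w: "(\<Sum>k\<in>UNIV. s $ k * s $ k / d k) = s \<bullet> E s" by (simp add: inner_vec_def)
    have "(K ** Kinverse s) $ i $ j = (\<Sum>k\<in>UNIV. ((if i = k then d i else 0) + m * s $ i * s $ k) *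
        ((if k = j then 1 / d j else 0) - m * s $ k * s $ j / (d k * d j * G s)))"
      using R by (simp add: matrix_matrix_mult_def assms Kinverse_def)
    also have "\<dots> = (\<Sum>k\<in>UNIV. (if i = k then d i * ((if k = j then 1 / d j else 0) - m * s $ k * s $ j / (d k * d j * G s)) else 0)
        + (if k = j then m * s $ i * s $ k / d j else 0)
        - m * s $ i * (m * s $ j / (d j * G s)) * (s $ k * s $ k / d k))"
      by (intro sum.cong refl) (auto simp: field_simps)
    also have "\<dots> = d i * ((if i = j then 1 / d j else 0) - m * s $ i * s $ j / (d i * d j * G s))
        + m * s $ i * s $ j / d j - m * s $ i * (m * s $ j / (d j * G s)) * (s \<bullet> E s)"
      unfolding sum.distrib sum_subtractf sum_distrib_left[symmetric] w by simp
    also have "m * s $ i * (m * s $ j / (d j * G s)) * (s \<bullet> E s) = m * s $ i * s $ j / (d j * G s) * (m * (s \<bullet> E s))"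
      by simp
    also have "d i * ((if i = j then 1 / d j else 0) - m * s $ i * s $ j / (d i * d j * G s))
        + m * s $ i * s $ j / d j - m * s $ i * s $ j / (d j * G s) * (m * (s \<bullet> E s)) = (if i = j then 1 else 0)"
      unfolding s_E_s using d[of i] d[of j] by (auto simp: field_simps)
    finally show ?thesis .
  qed
  then show "K ** Kinverse s = mat 1" by (simp add: vec_eq_iff mat_def)
qed

lemma energy_Kinverse: "(1/2) * (\<Sum>i\<in>UNIV. \<Sum>j\<in>UNIV. Kinverse s $ i $ j * p $ i * p $ j) = energy s p"
proof -
  have "(\<Sum>i\<in>UNIV. \<Sum>j\<in>UNIV. Kinverse s $ i $ j * p $ i * p $ j) =
      (\<Sum>i\<in>UNIV. \<Sum>j\<in>UNIV. (if i = j then R\<^sup>2 * (p $ i * p $ j / d j) else 0)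
         - R\<^sup>2 * m / G s * ((s $ i * p $ i / d i) * (s $ j * p $ j / d j)))"
    by (intro sum.cong refl) (auto simp: Kinverse_def algebra_simps)
  also have "\<dots> = R\<^sup>2 * (p \<bullet> E p) - R\<^sup>2 * m / G s * ((s \<bullet> E p) * (s \<bullet> E p))"
    by (simp add: sum_subtractf inner_vec_def sum_product sum_distrib_left sum_divide_distrib mult_ac)
  finally show ?thesis by (simp add: energy_def power2_eq_square algebra_simps)
qed


section \<open>Derivatives and divergence of the reduced field, and its invariant measure\<close>

definition ratio' :: "(real^'m) \<times> (real^'m) \<Rightarrow> (real^'m) \<times> (real^'m) \<Rightarrow> real" where
  "ratio' z w = ((fst w \<bullet> E (snd z) + fst z \<bullet> E (snd w)) * G (fst z)
     - (fst z \<bullet> E (snd z)) * (2 * m * (fst w \<bullet> E (fst z)))) / (G (fst z))\<^sup>2"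

definition vel' :: "(real^'m) \<times> (real^'m) \<Rightarrow> (real^'m) \<times> (real^'m) \<Rightarrow> real^'m" where
  "vel' z w = R\<^sup>2 *\<^sub>R (E (snd w) - (m * ratio' z w) *\<^sub>R E (fst z) - (m * ratio (fst z) (snd z)) *\<^sub>R E (fst w))"

definition force' :: "(real^'m) \<times> (real^'m) \<Rightarrow> (real^'m) \<times> (real^'m) \<Rightarrow> real^'m" where
  "force' z w = R\<^sup>2 *\<^sub>R ((m * ratio' z w) *\<^sub>R E (snd z) + (m * ratio (fst z) (snd z)) *\<^sub>R E (snd w)
       - (2 * m\<^sup>2 * ratio (fst z) (snd z) * ratio' z w) *\<^sub>R E (fst z) - (m * ratio (fst z) (snd z))\<^sup>2 *\<^sub>R E (fst w))
     - b *\<^sub>R ((fst w \<bullet> vel (fst z) (snd z) + fst z \<bullet> vel' z w) *\<^sub>R snd z + (fst z \<bullet> vel (fst z) (snd z)) *\<^sub>R snd w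
       - (snd w \<bullet> vel (fst z) (snd z) + snd z \<bullet> vel' z w) *\<^sub>R fst z - (snd z \<bullet> vel (fst z) (snd z)) *\<^sub>R fst w)"

lemma ratio_has_derivative: "((\<lambda>z. ratio (fst z) (snd z)) has_derivative ratio' z) (at z)"
  unfolding ratio_def G_def
  by (rule derivative_eq_intros E_derivative refl | simp add: G_def[symmetric])+
    (simp add: ratio'_def G_def fun_eq_iff E_sym power2_eq_square field_simps)

lemma vel_has_derivative: "((\<lambda>z. vel (fst z) (snd z)) has_derivative vel' z) (at z)"
  unfolding vel_def
  by (rule derivative_eq_intros E_derivative ratio_has_derivative refl)+
    (simp add: vel'_def fun_eq_iff algebra_simps)

lemma force_has_derivative: "((\<lambda>z. force (fst z) (snd z)) has_derivative force' z) (at z)"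
  unfolding force_def grad_energy_def
  by (rule derivative_eq_intros E_derivative ratio_has_derivative vel_has_derivative refl)+
    (simp add: force'_def fun_eq_iff algebra_simps power2_eq_square)

lemma ratio_continuous: "continuous_on UNIV (\<lambda>z. ratio (fst z) (snd z))"
  using ratio_has_derivative by (meson has_derivative_continuous continuous_at_imp_continuous_on)

lemma vel_continuous: "continuous_on UNIV (\<lambda>z. vel (fst z) (snd z))"
  using vel_has_derivative by (meson has_derivative_continuous continuous_at_imp_continuous_on)

lemma ratio'_continuous: "continuous_on UNIV (\<lambda>z. ratio' z w)"
  unfolding ratio'_def G_def
  by (intro continuous_intros E_continuous) (simp add: G_def[symmetric])

lemma vel'_continuous: "continuous_on UNIV (\<lambda>z. vel' z w)"
  unfolding vel'_def by (intro continuous_intros E_continuous ratio'_continuous ratio_continuous)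

lemma force'_continuous: "continuous_on UNIV (\<lambda>z. force' z w)"
  unfolding force'_def
  by (intro continuous_intros E_continuous ratio'_continuous ratio_continuous vel_continuous vel'_continuous)

text \<open>The Hamiltonian part contributes 0. In the momentum divergence of the rest,
  \<open>s . v\<close> is linear in \<open>p\<close> and \<open>p . v\<close> has momentum gradient
  \<open>2 v\<close>, so the bracket after \<open>b\<close> yields
  \<open>(1 + r - 2) (s . v)\<close> with r = \<open>CARD('m)\<close>.\<close>

lemma divergence:
  "(\<Sum>c\<in>Basis. (vel' z c, force' z c) \<bullet> c) = - b * (real CARD('m) - 1) * (fst z \<bullet> vel (fst z) (snd z))"
proof -
  obtain s p where z: "z = (s, p)" by (cases z)
  let ?e = "\<lambda>k. axis k 1 :: real^'m"
  have B: "(\<Sum>c\<in>Basis. f c) = (\<Sum>k\<in>UNIV. f (?e k))" for f :: "real^'m \<Rightarrow> real"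
  proof -
    have Basis: "(Basis :: (real^'m) set) = range ?e" by (auto simp: Basis_vec_def)
    have "inj ?e" by (auto simp: inj_on_def axis_eq_axis)
    then show ?thesis unfolding Basis by (simp add: sum.reindex)
  qed
  have BB: "(\<Sum>c\<in>Basis. f c) = (\<Sum>c\<in>Basis. f (c, 0)) + (\<Sum>c\<in>Basis. f (0, c))"
    for f :: "(real^'m) \<times> (real^'m) \<Rightarrow> real"
    unfolding Basis_prod_def
    by (subst sum.union_disjoint) (auto simp: sum.reindex inj_on_def nonzero_Basis)
  have E0: "E 0 = 0" by (simp add: vec_eq_iff)
  have als: "ratio' z (?e k, 0) = p $ k / d k / G s - ratio s p * (2 * m * (s $ k / d k)) / G s" for k
    by (simp add: ratio'_def z E0 axis_E ratio_def power2_eq_square diff_divide_distrib)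
  have alp: "ratio' z (0, ?e k) = s $ k / d k / G s" for k
    by (simp add: ratio'_def z E0 E_axis power2_eq_square)
  have velp: "vel' z (0, ?e k) = R\<^sup>2 *\<^sub>R (E (?e k) - (m * (s $ k / d k / G s)) *\<^sub>R E s)" for k
    unfolding vel'_def alp by (simp add: z E0)
  have sv: "s \<bullet> vel' z (0, ?e k) = R\<^sup>2 * (s $ k / d k / G s)" for k
  proof -
    have "s \<bullet> vel' z (0, ?e k) = R\<^sup>2 * (s $ k / d k - s $ k / d k / G s * (m * (s \<bullet> E s)))"
      by (simp add: velp inner_diff_right E_axis)
    also have "\<dots> = R\<^sup>2 * (s $ k / d k / G s)" unfolding s_E_s by (simp add: field_simps)
    finally show ?thesis .
  qed
  have pv: "p \<bullet> vel' z (0, ?e k) = vel s p $ k" for k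
    by (simp add: velp inner_diff_right E_axis vel_def ratio_def E_sym[of p s] mult_ac)
  have t1: "vel' z (?e k, 0) \<bullet> ?e k = R\<^sup>2 * (- (m * ratio' z (?e k, 0)) * (s $ k / d k) - m * ratio s p / d k)" for k
    unfolding vel'_def by (simp add: inner_axis z E0)
  have t2: "force' z (0, ?e k) \<bullet> ?e k =
      R\<^sup>2 * ((m * (s $ k / d k / G s)) * (p $ k / d k) + m * ratio s p / d k - (2 * m\<^sup>2 * ratio s p * (s $ k / d k / G s)) * (s $ k / d k))
      - b * (R\<^sup>2 * (s $ k / d k / G s) * p $ k + s \<bullet> vel s p - (vel s p $ k + vel s p $ k) * s $ k)" for k
    unfolding force'_def sv[unfolded z] pv[unfolded z] alp[unfolded z] z fst_conv snd_conv
    by (simp add: inner_axis inner_axis' sv[unfolded z] pv[unfolded z] E0)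
  have sum1: "(\<Sum>k\<in>UNIV. s $ k / d k / G s * p $ k) = ratio s p"
    by (simp add: ratio_def inner_vec_def sum_divide_distrib)
  have sum2: "(\<Sum>k\<in>UNIV. vel s p $ k * s $ k) = s \<bullet> vel s p"
    by (simp add: inner_vec_def mult.commute)
  have "(\<Sum>c\<in>Basis. (vel' z c, force' z c) \<bullet> c)
      = (\<Sum>k\<in>UNIV. vel' z (?e k, 0) \<bullet> ?e k + force' z (0, ?e k) \<bullet> ?e k)"
    by (simp add: BB B sum.distrib)
  \<comment> \<open>For each index \<open>k\<close> the Hamiltonian contributions of
    \<open>t1\<close> and \<open>t2\<close> cancel, as equal mixed second derivatives of the
    energy.\<close>
  also have "\<dots> = (\<Sum>k\<in>UNIV. - b * (R\<^sup>2 * (s $ k / d k / G s * p $ k) + s \<bullet> vel s p - 2 * (vel s p $ k * s $ k)))"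
    unfolding t1 t2 als by (intro sum.cong refl) (simp add: field_simps power2_eq_square)
  also have "\<dots> = - b * (R\<^sup>2 * ratio s p + real CARD('m) * (s \<bullet> vel s p) - 2 * (s \<bullet> vel s p))"
    unfolding sum_distrib_left[symmetric] sum_subtractf sum.distrib sum1 sum2 by simp
  finally show ?thesis unfolding z fst_conv snd_conv inner_vel by (simp add: algebra_simps)
qed

lemma invariant_measure_exp_square:
  "invariant_measure (\<lambda>z. (vel (fst z) (snd z), force (fst z) (snd z)))
     (\<lambda>z. exp (b * (real CARD('m) - 1) / 2 * (fst z \<bullet> fst z)))"
proof -
  \<comment> \<open>The type \<open>'m bit0\<close> is well-ordered and has
    \<open>2 * CARD('m)\<close> elements, the dimension of phase space.\<close>
  have "CARD('m bit0) = card (Basis :: ((real^'m) \<times> (real^'m)) set)"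
    by (simp add: DIM_prod[symmetric] del: DIM_prod) (simp add: DIM_prod DIM_cart)
  then obtain \<beta> :: "'m bit0 \<Rightarrow> (real^'m) \<times> (real^'m)" where "bij_betw \<beta> UNIV Basis"
    using finite_same_card_bij[of "UNIV :: 'm bit0 set" "Basis :: ((real^'m) \<times> (real^'m)) set"] by auto
  then interpret basis_chart \<beta> by unfold_locales
  define c where "c = b * (real CARD('m) - 1)"
  define \<rho> where "\<rho> z = exp (c / 2 * (fst z \<bullet> fst z))" for z :: "(real^'m) \<times> (real^'m)"
  have "invariant_measure (\<lambda>z. (vel (fst z) (snd z), force (fst z) (snd z))) \<rho>"
  proof (rule liouville_invariant_measure[where V'="\<lambda>z w. (vel' z w, force' z w)"
        and G="\<lambda>z. (\<rho> z * c) *\<^sub>R (fst z, 0)"])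
    show "((\<lambda>z. (vel (fst z) (snd z), force (fst z) (snd z))) has_derivative (\<lambda>w. (vel' z w, force' z w))) (at z)" for z
      by (intro has_derivative_Pair vel_has_derivative force_has_derivative)
    show "continuous_on UNIV (\<lambda>z. (vel' z v, force' z v))" for v
      by (intro continuous_intros vel'_continuous force'_continuous)
    show "\<rho> z > 0" for z by (simp add: \<rho>_def)
    show "(\<rho> has_derivative (\<bullet>) ((\<rho> z * c) *\<^sub>R (fst z, 0))) (at z)" for z
      unfolding \<rho>_def by (rule derivative_eq_intros refl)+ (simp add: fun_eq_iff inner_prod_def inner_commute)
    show "continuous_on UNIV (\<lambda>z. (\<rho> z * c) *\<^sub>R (fst z, 0 :: real^'m))"
      unfolding \<rho>_def by (intro continuous_intros)
    show "(\<rho> z * c) *\<^sub>R (fst z, 0) \<bullet> (vel (fst z) (snd z), force (fst z) (snd z))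
       + \<rho> z * (\<Sum>b\<in>Basis. (vel' z b, force' z b) \<bullet> b) = 0" for z
      unfolding divergence by (simp add: c_def algebra_simps)
  qed
  then show ?thesis unfolding \<rho>_def c_def .
qed

section \<open>Rescaled Hamiltonian and Chaplygin Hamiltonisation\<close>

lemma vel_scaleR: "vel s (c *\<^sub>R p) = c *\<^sub>R vel s p"
  by (simp add: vel_def ratio_def E_scaleR algebra_simps)

lemma energy_scaleR: "energy s (c *\<^sub>R p) = c\<^sup>2 * energy s p"
  by (simp add: energy_def E_scaleR power_mult_distrib power2_eq_square algebra_simps)

lemma grad_energy_scaleR: "grad_energy s (c *\<^sub>R p) = c\<^sup>2 *\<^sub>R grad_energy s p"
  by (simp add: grad_energy_def ratio_def E_scaleR power_mult_distrib power2_eq_square algebra_simps)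

lemma dP_energy: "dP energy s p i = vel s p $ i"
  unfolding dP_def by (rule DERIV_imp_deriv[OF energy_derivative_p])

lemma dS_energy: "dS energy s p i = grad_energy s p $ i"
  unfolding dS_def by (rule DERIV_imp_deriv[OF energy_derivative_s])

text \<open>By homogeneity the rescaled energy is \<open>exp (- 2 \<phi>)\<close> times the energy.
  Its position gradient thus has the additional term \<open>- 2 H\<close> times grad
  \<open>\<phi>\<close>, which is \<open>b s\<close>; at the rescaled momentum the exponential
  factors cancel.\<close>

lemma hamVF_rescaled:
  fixes \<phi> :: "real^'m \<Rightarrow> real"
  defines "\<phi> \<equiv> \<lambda>s. b / 2 * (s \<bullet> s)"
  shows "hamVF (\<lambda>s pt. energy s (exp (- \<phi> s) *\<^sub>R pt)) (s, exp (\<phi> s) *\<^sub>R p)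
    = (exp (- \<phi> s) *\<^sub>R vel s p, - grad_energy s p + (2 * b * energy s p) *\<^sub>R s)"
proof -
  let ?H = "\<lambda>s pt. energy s (exp (- \<phi> s) *\<^sub>R pt)"
  have H: "?H s pt = exp (- 2 * \<phi> s) * energy s pt" for s pt
    by (simp add: energy_scaleR power2_eq_square flip: exp_add)
  have e: "exp (- 2 * \<phi> s) * (exp (\<phi> s))\<^sup>2 = 1" "exp (- 2 * \<phi> s) * exp (\<phi> s) = exp (- \<phi> s)"
    by (simp_all add: power2_eq_square flip: exp_add)
  have P: "dP ?H s (exp (\<phi> s) *\<^sub>R p) i = exp (- \<phi> s) * vel s p $ i" for i
  proof -
    have "((\<lambda>t. exp (- 2 * \<phi> s) * energy s (exp (\<phi> s) *\<^sub>R p + t *\<^sub>R axis i 1)) has_real_derivative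
        exp (- 2 * \<phi> s) * vel s (exp (\<phi> s) *\<^sub>R p) $ i) (at 0)"
      by (intro DERIV_cmult energy_derivative_p)
    moreover have "exp (- 2 * \<phi> s) * vel s (exp (\<phi> s) *\<^sub>R p) $ i = exp (- \<phi> s) * vel s p $ i"
      unfolding vel_scaleR by (simp add: e(2)[symmetric])
    ultimately show ?thesis unfolding dP_def H by (metis DERIV_imp_deriv)
  qed
  have S: "dS ?H s (exp (\<phi> s) *\<^sub>R p) i = grad_energy s p $ i - 2 * b * energy s p * s $ i" for i
  proof -
    have \<phi>: "\<phi> (s + t *\<^sub>R axis i 1) = \<phi> s + t * (b * s $ i) + t * t * (b / 2)" for t
      by (simp add: \<phi>_def inner_add_left inner_add_right inner_axis inner_axis' algebra_simps)
    have "((\<lambda>t. exp (- 2 * \<phi> (s + t *\<^sub>R axis i 1))) has_real_derivative exp (- 2 * \<phi> s) * (- 2 * (b * s $ i))) (at 0)"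
      unfolding \<phi> by (auto intro!: derivative_eq_intros)
    from DERIV_mult[OF this energy_derivative_s[of s i "exp (\<phi> s) *\<^sub>R p"]]
    have "((\<lambda>t. exp (- 2 * \<phi> (s + t *\<^sub>R axis i 1)) * energy (s + t *\<^sub>R axis i 1) (exp (\<phi> s) *\<^sub>R p)) has_real_derivative
      exp (- 2 * \<phi> s) * (exp (\<phi> s))\<^sup>2 * (grad_energy s p $ i - 2 * b * energy s p * s $ i)) (at 0)"
      by (rule DERIV_cong) (simp add: grad_energy_scaleR energy_scaleR algebra_simps)
    then show ?thesis unfolding dS_def H e(1) by (simp add: DERIV_imp_deriv)
  qed
  show ?thesis unfolding hamVF_def by (simp add: P S vec_eq_iff)
qed


text \<open>The identification of the reduced equations with the explicit field, and the place where
  the two cases enter. If \<open>a = 0\<close>, both the bracket pairings and \<open>b\<close>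
  vanish, whatever \<open>d0\<close> is; otherwise all weights equal \<open>d0\<close>.\<close>

lemma
  fixes J :: "real^('m option)^('m option)" and a d0 :: real
  assumes J: "\<forall>i j. i \<noteq> j \<longrightarrow> J $ i $ j = 0"
    and dJ: "\<And>i. d i = J $ Some i $ Some i + J $ None $ None + m * a\<^sup>2"
    and ad: "a = 0 \<or> (\<forall>i. d i = d0)" and b: "b = m * a / (R * d0)"
  shows Ham_eq: "Ham R a m J = energy"
    and reducedVF_eq: "reducedVF R a m J = (\<lambda>z. (vel (fst z) (snd z), force (fst z) (snd z)))"
proof -
  have Rnz: "R \<noteq> 0" using R by simp
  have Kinv: "Kinv R a m J s = Kinverse s" for s
    unfolding Kinv_def by (rule matrix_inv_K) (simp add: Kmat_eq[OF J Rnz] dJ)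
  show Ham: "Ham R a m J = energy"
    by (intro ext) (simp only: Ham_def Kinv energy_Kinverse)
  have C: "Ccoef R a m J s i j k = b * ((if k = i then s $ j else 0) - (if k = j then s $ i else 0))" for s i j k
  proof -
    have "Ccoef R a m J s i j k = (\<Sum>l\<in>UNIV. (if i = l then m * a / R ^ 3 * (Kinverse s $ k $ l * s $ j) else 0)
        - (if j = l then m * a / R ^ 3 * (Kinverse s $ k $ l * s $ i) else 0))"
      unfolding Ccoef_def Kinv metric_lie_bracket_hor[OF J Rnz]
      by (intro sum.cong refl) (auto simp: algebra_simps)
    also have "\<dots> = m * a / R ^ 3 * (Kinverse s $ k $ i * s $ j - Kinverse s $ k $ j * s $ i)"
      unfolding sum_subtractf by (simp add: algebra_simps)
    also have "\<dots> = b * ((if k = i then s $ j else 0) - (if k = j then s $ i else 0))"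
    proof (cases "a = 0")
      case True then show ?thesis using b by simp
    next
      case False
      then have d0: "d l = d0" for l using ad by blast
      then have "d0 \<noteq> 0" using d_nz by metis
      \<comment> \<open>With equal weights the rank-one parts of the two terms are the same multiple
        of \<open>s_k s_i s_j\<close> and cancel; only the diagonal \<open>R^2 / d0\<close> is left,
        and its product with \<open>m a / R^3\<close> is \<open>b\<close>.\<close>
      have "Kinverse s $ k $ i * s $ j - Kinverse s $ k $ j * s $ i
          = R\<^sup>2 / d0 * ((if k = i then s $ j else 0) - (if k = j then s $ i else 0))"
        by (simp add: Kinverse_def d0 algebra_simps)
      then show ?thesis using Rnz \<open>d0 \<noteq> 0\<close>
        unfolding b by (simp add: power2_eq_square power3_eq_cube)
    qed
    finally show ?thesis .
  qed
  have "(\<Sum>j\<in>UNIV. \<Sum>k\<in>UNIV. Ccoef R a m J s i j k * p $ k * vel s p $ j)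
      = b * ((s \<bullet> vel s p) * p $ i - (p \<bullet> vel s p) * s $ i)" for s p i
  proof -
    have inner: "(\<Sum>k\<in>UNIV. Ccoef R a m J s i j k * p $ k * vel s p $ j)
        = b * p $ i * (s $ j * vel s p $ j) - b * s $ i * (p $ j * vel s p $ j)" for j
    proof -
      have "(\<Sum>k\<in>UNIV. Ccoef R a m J s i j k * p $ k * vel s p $ j) =
        (\<Sum>k\<in>UNIV. (if k = i then b * s $ j * p $ k * vel s p $ j else 0) - (if k = j then b * s $ i * p $ k * vel s p $ j else 0))"
        unfolding C by (intro sum.cong refl) (auto simp: algebra_simps)
      also have "\<dots> = b * p $ i * (s $ j * vel s p $ j) - b * s $ i * (p $ j * vel s p $ j)"
        unfolding sum_subtractf by (simp add: algebra_simps)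
      finally show ?thesis .
    qed
    show ?thesis
      unfolding inner sum_subtractf sum_distrib_left[symmetric] by (simp add: inner_vec_def algebra_simps)
  qed
  then show "reducedVF R a m J = (\<lambda>z. (vel (fst z) (snd z), force (fst z) (snd z)))"
    unfolding reducedVF_def Let_def Ham by (intro ext) (simp add: dP_energy dS_energy force_def vec_eq_iff)
qed

text \<open>The product rule for \<open>exp \<phi> * p\<close> in the new time produces
  \<open>force + b (s . v) p\<close>, since the time change cancels the exponential. The result is
  the momentum part of \<open>hamVF_rescaled\<close>.\<close>

lemma chaplygin_hamiltonisation_square:
  assumes Ham: "Ham R a m J = energy"
    and VF: "reducedVF R a m J = (\<lambda>z. (vel (fst z) (snd z), force (fst z) (snd z)))"
  shows "chaplygin_hamiltonisation R a m J (\<lambda>s. b / 2 * (s \<bullet> s))"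
proof -
  define \<phi> where "\<phi> s = b / 2 * (s \<bullet> s)" for s :: "real^'m"
  have "((\<lambda>\<tau>. (fst (z (\<theta> \<tau>)), exp (\<phi> (fst (z (\<theta> \<tau>)))) *\<^sub>R snd (z (\<theta> \<tau>)))) has_vector_derivative
      hamVF (\<lambda>s pt. energy s (exp (- \<phi> s) *\<^sub>R pt)) (fst (z (\<theta> \<tau>)), exp (\<phi> (fst (z (\<theta> \<tau>)))) *\<^sub>R snd (z (\<theta> \<tau>)))) (at \<tau>)"
    if z: "(z has_vector_derivative (vel (fst (z (\<theta> \<tau>))) (snd (z (\<theta> \<tau>))), force (fst (z (\<theta> \<tau>))) (snd (z (\<theta> \<tau>))))) (at (\<theta> \<tau>))"
      and \<theta>: "(\<theta> has_real_derivative exp (- \<phi> (fst (z (\<theta> \<tau>))))) (at \<tau>)" for z \<theta> \<tau>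
  proof -
    define s p where "s = fst (z (\<theta> \<tau>))" and "p = snd (z (\<theta> \<tau>))"
    define x where "x = z \<circ> \<theta>"
    have "(x has_vector_derivative exp (- \<phi> s) *\<^sub>R (vel s p, force s p)) (at \<tau>)"
      unfolding x_def s_def p_def
      by (rule vector_diff_chain_at[OF \<theta>[unfolded has_real_derivative_iff_has_vector_derivative] z])
    then have x: "(x has_derivative (\<lambda>h. h *\<^sub>R (exp (- \<phi> s) *\<^sub>R (vel s p, force s p)))) (at \<tau>)"
      by (simp add: has_vector_derivative_def)
    have xs: "fst (x \<tau>) = s" "snd (x \<tau>) = p" by (simp_all add: x_def s_def p_def)
    have ds: "((\<lambda>\<tau>. fst (x \<tau>)) has_derivative (\<lambda>h. h *\<^sub>R (exp (- \<phi> s) *\<^sub>R vel s p))) (at \<tau>)"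
      using has_derivative_fst[OF x] by simp
    have dp: "((\<lambda>\<tau>. snd (x \<tau>)) has_derivative (\<lambda>h. h *\<^sub>R (exp (- \<phi> s) *\<^sub>R force s p))) (at \<tau>)"
      using has_derivative_snd[OF x] by simp
    have de: "((\<lambda>\<tau>. exp (\<phi> (fst (x \<tau>)))) has_derivative (\<lambda>h. h * (b * (s \<bullet> vel s p)))) (at \<tau>)"
      unfolding \<phi>_def
      by (rule derivative_eq_intros ds refl)+
        (simp add: xs fun_eq_iff inner_commute \<phi>_def[symmetric] mult_ac flip: exp_add mult_exp_exp, simp add: \<phi>_def exp_minus)
    \<comment> \<open>The two multiples of \<open>(s . v) p\<close> cancel and \<open>p . v\<close>
      is replaced by twice the energy.\<close>
    have eq: "exp (\<phi> s) *\<^sub>R (h *\<^sub>R (exp (- \<phi> s) *\<^sub>R force s p)) + (h * (b * (s \<bullet> vel s p))) *\<^sub>R p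
        = h *\<^sub>R (- grad_energy s p + (2 * b * energy s p) *\<^sub>R s)" for h
    proof -
      have "exp (\<phi> s) *\<^sub>R (h *\<^sub>R (exp (- \<phi> s) *\<^sub>R force s p)) = h *\<^sub>R force s p"
        by (simp add: exp_minus)
      then show ?thesis by (simp add: force_def inner_vel_energy algebra_simps)
    qed
    have "((\<lambda>\<tau>. exp (\<phi> (fst (x \<tau>))) *\<^sub>R snd (x \<tau>)) has_derivative
        (\<lambda>h. h *\<^sub>R (- grad_energy s p + (2 * b * energy s p) *\<^sub>R s))) (at \<tau>)"
      using has_derivative_scaleR[OF de dp] unfolding xs eq .
    from has_derivative_Pair[OF ds this]
    have "((\<lambda>\<tau>. (fst (x \<tau>), exp (\<phi> (fst (x \<tau>))) *\<^sub>R snd (x \<tau>))) has_vector_derivative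
        (exp (- \<phi> s) *\<^sub>R vel s p, - grad_energy s p + (2 * b * energy s p) *\<^sub>R s)) (at \<tau>)"
      by (simp add: has_vector_derivative_def)
    then show ?thesis
      using hamVF_rescaled[of s p] by (simp add: x_def \<phi>_def s_def p_def)
  qed
  then show ?thesis
    unfolding chaplygin_hamiltonisation_def Let_def VF Ham \<phi>_def
    using smooth_fun_square_norm[of "b / 2"] by blast
qed

end

theorem mainTheorem6:
  fixes R a mass :: real and J :: "real^('m::finite option)^('m option)"
  assumes n_ge_3: "CARD('m) + 1 \<ge> 3"
    and R_pos: "R > 0" and mass_pos: "mass > 0"
    and J_sym: "transpose J = J"
    and J_posdef: "\<forall>v. v \<noteq> 0 \<longrightarrow> v \<bullet> (J *v v) > 0"
    and cases: "((\<forall>i j. i \<noteq> j \<longrightarrow> J $ i $ j = 0) \<and> a = 0)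
              \<or> (\<exists>J1 Jn. \<forall>i j. J $ i $ j =
                   (if i = j then (if i = None then Jn else J1) else 0))"
  shows "(\<exists>\<sigma>. smooth_fun \<sigma> \<and>
            invariant_measure (reducedVF R a mass J) (\<lambda>z. exp (\<sigma> (fst z))))
       \<and> (\<exists>\<phi>. chaplygin_hamiltonisation R a mass J \<phi>)"
proof -
  have diag: "\<forall>i j. i \<noteq> j \<longrightarrow> J $ i $ j = 0" using cases by auto
  have Jpos: "J $ k $ k > 0" for k
  proof -
    have "axis k 1 \<bullet> (J *v axis k 1) > 0" using J_posdef by (simp add: axis_eq_0_iff)
    then show ?thesis by (simp add: matrix_vector_mult_basis column_def inner_axis')
  qed
  define d where "d i = J $ Some i $ Some i + J $ None $ None + mass * a\<^sup>2" for i
  \<comment> \<open>In the second alternative \<open>d0 = J1 + Jn + mass a^2\<close>; in the first,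
    where \<open>a = 0\<close>, any value serves and \<open>b = 0\<close>, so \<open>\<phi>\<close>
    and \<open>\<sigma>\<close> are zero.\<close>
  obtain d0 where d0: "a = 0 \<or> (\<forall>i. d i = d0)"
    using cases unfolding d_def by fastforce
  define b where "b = mass * a / (R * d0)"
  interpret reduced_system R mass b d
    using R_pos mass_pos Jpos by unfold_locales (simp_all add: d_def add_pos_nonneg add_pos_pos)
  note eqs = Ham_eq[OF diag d_def d0 b_def] reducedVF_eq[OF diag d_def d0 b_def]
  show ?thesis
    \<comment> \<open>The witnesses are \<open>b / 2 |s|^2\<close> for \<open>\<phi>\<close> and
      \<open>CARD('m) - 1\<close>, that is n - 2, times it for \<open>\<sigma>\<close>.\<close>
    using chaplygin_hamiltonisation_square[OF eqs] invariant_measure_exp_square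
      smooth_fun_square_norm[of "b * (real CARD('m) - 1) / 2"] unfolding eqs(2) by blast
qed

end
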